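(* Let $R$ and $S$ be rings and let $W$ be an $(R,S)$-bimodule. Then the adjoint category $\mathrm{Adj}(W)$ is not equivalent to a full category of modules (the category of all modules over a ring, with all module homomorphisms), nor to the dual (opposite) of a full category of modules.
   Context: Homomorphisms of left $R$-modules are written on the right of their arguments ($u\mu$), homomorphisms of right $S$-modules on the left ($\nu v$). For a left $R$-module $U$, a right $S$-module $V$ and an $(R,S)$-bimodule $W$, an $(R,S)$-bimap is a function $B:U\times V\to W$, written $uBv$, that is additive in each variable and satisfies $(ru)Bv=r(uBv)$ and $uB(vs)=(uBv)s$ for all $r\in R$, $s\in S$, $u\in U$, $v\in V$. The adjoint category $\mathrm{Adj}(W)$ (with the $(R,S)$-bimodule $W$ fixed) has as objects all $(R,S)$-bimaps $B:U\times V\to W$ into $W$. A morphism from $B:U\times V\to W$ to $C:U'\times V'\to W$ is a pair $(\overleftarrow{\mu},\overrightarrow{\mu})$ with $\overleftarrow{\mu}\in\mathrm{Hom}_R(U,U')$ and $\overrightarrow{\mu}\in\mathrm{Hom}_S(V',V)$ such that $(u\overleftarrow{\mu})Cv'=uB(\overrightarrow{\mu}v')$ for all $u\in U$, $v'\in V'$. The composite of $(\overleftarrow{\mu},\overrightarrow{\mu}):B\to C$ followed by $(\overleftarrow{\nu},\overrightarrow{\nu}):C\to D$ is the pair consisting of $u\mapsto (u\overleftarrow{\mu})\overleftarrow{\nu}$ and $v\mapsto \overrightarrow{\mu}(\overrightarrow{\nu}v)$.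
   Formalization: R and S are assumed nonzero: if S = 0 then Adj(W) is equivalent to the category of left R-modules, and if R = 0 to the dual of the category of right S-modules, so the claim fails there. "All modules" means all modules in an arbitrary fixed universe of sets in which R and S are small. *)

theory Defs
  imports "HOL-Algebra.Module" "HOL-Library.Equipollence"
begin

section \<open>Modules over not necessarily commutative rings\<close>

text \<open>
  The locale \<^locale>\<open>module\<close> of the library requires a commutative ring.  We use its record
  type \<^typ>\<open>('a, 'b) module\<close> for left and right modules alike; the fields for the ring
  multiplication and unit of the underlying \<^typ>\<open>'b ring\<close> are unconstrained and never used.
  The locale \<^locale>\<open>ring\<close> does not exclude the zero ring.
\<close>

locale left_module = R?: ring R + M?: abelian_group M for R (structure) and M (structure) +
  assumes smult_closed: "\<lbrakk>a \<in> carrier R; x \<in> carrier M\<rbrakk> \<Longrightarrow> a \<odot>\<^bsub>M\<^esub> x \<in> carrier M"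
    and smult_l_distr: "\<lbrakk>a \<in> carrier R; b \<in> carrier R; x \<in> carrier M\<rbrakk>
      \<Longrightarrow> (a \<oplus> b) \<odot>\<^bsub>M\<^esub> x = a \<odot>\<^bsub>M\<^esub> x \<oplus>\<^bsub>M\<^esub> b \<odot>\<^bsub>M\<^esub> x"
    and smult_r_distr: "\<lbrakk>a \<in> carrier R; x \<in> carrier M; y \<in> carrier M\<rbrakk>
      \<Longrightarrow> a \<odot>\<^bsub>M\<^esub> (x \<oplus>\<^bsub>M\<^esub> y) = a \<odot>\<^bsub>M\<^esub> x \<oplus>\<^bsub>M\<^esub> a \<odot>\<^bsub>M\<^esub> y"
    and smult_assoc: "\<lbrakk>a \<in> carrier R; b \<in> carrier R; x \<in> carrier M\<rbrakk>
      \<Longrightarrow> (a \<otimes> b) \<odot>\<^bsub>M\<^esub> x = a \<odot>\<^bsub>M\<^esub> (b \<odot>\<^bsub>M\<^esub> x)"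
    and smult_one: "x \<in> carrier M \<Longrightarrow> \<one> \<odot>\<^bsub>M\<^esub> x = x"

text \<open>
  For a right module, \<open>a \<odot>\<^bsub>M\<^esub> x\<close> stands for the product written \<open>xa\<close> on paper, whence
  the order of the factors in \<open>smult_assoc\<close>: it says \<open>x(ab) = (xa)b\<close>.
\<close>

locale right_module = R?: ring R + M?: abelian_group M for R (structure) and M (structure) +
  assumes smult_closed: "\<lbrakk>a \<in> carrier R; x \<in> carrier M\<rbrakk> \<Longrightarrow> a \<odot>\<^bsub>M\<^esub> x \<in> carrier M"
    and smult_l_distr: "\<lbrakk>a \<in> carrier R; b \<in> carrier R; x \<in> carrier M\<rbrakk>
      \<Longrightarrow> (a \<oplus> b) \<odot>\<^bsub>M\<^esub> x = a \<odot>\<^bsub>M\<^esub> x \<oplus>\<^bsub>M\<^esub> b \<odot>\<^bsub>M\<^esub> x"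
    and smult_r_distr: "\<lbrakk>a \<in> carrier R; x \<in> carrier M; y \<in> carrier M\<rbrakk>
      \<Longrightarrow> a \<odot>\<^bsub>M\<^esub> (x \<oplus>\<^bsub>M\<^esub> y) = a \<odot>\<^bsub>M\<^esub> x \<oplus>\<^bsub>M\<^esub> a \<odot>\<^bsub>M\<^esub> y"
    and smult_assoc: "\<lbrakk>a \<in> carrier R; b \<in> carrier R; x \<in> carrier M\<rbrakk>
      \<Longrightarrow> (a \<otimes> b) \<odot>\<^bsub>M\<^esub> x = b \<odot>\<^bsub>M\<^esub> (a \<odot>\<^bsub>M\<^esub> x)"
    and smult_one: "x \<in> carrier M \<Longrightarrow> \<one> \<odot>\<^bsub>M\<^esub> x = x"

text \<open>
  Homomorphisms are required to be \<^const>\<open>undefined\<close> outside the carrier, so that equality in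
  HOL is equality of homomorphisms.  The same definition serves left and right modules.
\<close>

definition mod_hom ::
    "('r, 'q) ring_scheme \<Rightarrow> ('r, 'a, 'm) module_scheme \<Rightarrow> ('r, 'b, 'n) module_scheme \<Rightarrow> ('a \<Rightarrow> 'b) set"
  where "mod_hom R M N = {f \<in> carrier M \<rightarrow>\<^sub>E carrier N.
     (\<forall>x \<in> carrier M. \<forall>y \<in> carrier M. f (x \<oplus>\<^bsub>M\<^esub> y) = f x \<oplus>\<^bsub>N\<^esub> f y) \<and>
     (\<forall>a \<in> carrier R. \<forall>x \<in> carrier M. f (a \<odot>\<^bsub>M\<^esub> x) = a \<odot>\<^bsub>N\<^esub> f x)}"

record ('r, 's, 'w) bimodule = "('r, 'w) module" +
  rsmult :: "['w, 's] \<Rightarrow> 'w" (infixl \<open>\<odot>\<^sub>r\<index>\<close> 70)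

definition right_part :: "('r, 's, 'w, 'c) bimodule_scheme \<Rightarrow> ('s, 'w) module"
  where "right_part W = \<lparr>carrier = carrier W, mult = mult W, one = one W,
     zero = zero W, add = add W, smult = (\<lambda>s w. w \<odot>\<^sub>r\<^bsub>W\<^esub> s)\<rparr>"

definition is_bimodule ::
    "('r, 'p) ring_scheme \<Rightarrow> ('s, 'q) ring_scheme \<Rightarrow> ('r, 's, 'w, 'c) bimodule_scheme \<Rightarrow> bool"
  where "is_bimodule R S W \<longleftrightarrow> left_module R W \<and> right_module S (right_part W) \<and>
     (\<forall>r \<in> carrier R. \<forall>s \<in> carrier S. \<forall>w \<in> carrier W.
        (r \<odot>\<^bsub>W\<^esub> w) \<odot>\<^sub>r\<^bsub>W\<^esub> s = r \<odot>\<^bsub>W\<^esub> (w \<odot>\<^sub>r\<^bsub>W\<^esub> s))"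


section \<open>Categories\<close>

text \<open>
  Categories are given by families of hom-sets, which need not be disjoint; therefore composition
  takes the three objects involved as arguments.  \<open>Comp C a b c f g\<close> is \<open>f : a \<rightarrow> b\<close> followed by
  \<open>g : b \<rightarrow> c\<close>.
\<close>

record ('o, 'm) cat =
  Obj :: "'o set"
  Hom :: "['o, 'o] \<Rightarrow> 'm set"
  Id :: "'o \<Rightarrow> 'm"
  Comp :: "['o, 'o, 'o, 'm, 'm] \<Rightarrow> 'm"

definition category :: "('o, 'm) cat \<Rightarrow> bool"
  where "category C \<longleftrightarrow>
     (\<forall>a \<in> Obj C. Id C a \<in> Hom C a a) \<and>
     (\<forall>a \<in> Obj C. \<forall>b \<in> Obj C. \<forall>c \<in> Obj C. \<forall>f \<in> Hom C a b. \<forall>g \<in> Hom C b c.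
        Comp C a b c f g \<in> Hom C a c) \<and>
     (\<forall>a \<in> Obj C. \<forall>b \<in> Obj C. \<forall>f \<in> Hom C a b.
        Comp C a a b (Id C a) f = f \<and> Comp C a b b f (Id C b) = f) \<and>
     (\<forall>a \<in> Obj C. \<forall>b \<in> Obj C. \<forall>c \<in> Obj C. \<forall>d \<in> Obj C.
        \<forall>f \<in> Hom C a b. \<forall>g \<in> Hom C b c. \<forall>h \<in> Hom C c d.
        Comp C a c d (Comp C a b c f g) h = Comp C a b d f (Comp C b c d g h))"

definition op_cat :: "('o, 'm) cat \<Rightarrow> ('o, 'm) cat"
  where "op_cat C = \<lparr>Obj = Obj C, Hom = (\<lambda>a b. Hom C b a), Id = Id C,
     Comp = (\<lambda>a b c f g. Comp C c b a g f)\<rparr>"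

definition is_functor ::
    "('o, 'm) cat \<Rightarrow> ('o2, 'm2) cat \<Rightarrow> ('o \<Rightarrow> 'o2) \<Rightarrow> (['o, 'o, 'm] \<Rightarrow> 'm2) \<Rightarrow> bool"
  where "is_functor C D F\<^sub>o F\<^sub>m \<longleftrightarrow>
     (\<forall>a \<in> Obj C. F\<^sub>o a \<in> Obj D) \<and>
     (\<forall>a \<in> Obj C. \<forall>b \<in> Obj C. \<forall>f \<in> Hom C a b. F\<^sub>m a b f \<in> Hom D (F\<^sub>o a) (F\<^sub>o b)) \<and>
     (\<forall>a \<in> Obj C. F\<^sub>m a a (Id C a) = Id D (F\<^sub>o a)) \<and>
     (\<forall>a \<in> Obj C. \<forall>b \<in> Obj C. \<forall>c \<in> Obj C. \<forall>f \<in> Hom C a b. \<forall>g \<in> Hom C b c.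
        F\<^sub>m a c (Comp C a b c f g) = Comp D (F\<^sub>o a) (F\<^sub>o b) (F\<^sub>o c) (F\<^sub>m a b f) (F\<^sub>m b c g))"

definition is_isomorphism :: "('o, 'm) cat \<Rightarrow> 'o \<Rightarrow> 'o \<Rightarrow> 'm \<Rightarrow> bool"
  where "is_isomorphism C a b f \<longleftrightarrow> f \<in> Hom C a b \<and>
     (\<exists>g \<in> Hom C b a. Comp C a b a f g = Id C a \<and> Comp C b a b g f = Id C b)"

definition naturally_isomorphic ::
    "('o, 'm) cat \<Rightarrow> ('o2, 'm2) cat \<Rightarrow> ('o \<Rightarrow> 'o2) \<Rightarrow> (['o, 'o, 'm] \<Rightarrow> 'm2) \<Rightarrow>
     ('o \<Rightarrow> 'o2) \<Rightarrow> (['o, 'o, 'm] \<Rightarrow> 'm2) \<Rightarrow> bool"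
  where "naturally_isomorphic C D F\<^sub>o F\<^sub>m G\<^sub>o G\<^sub>m \<longleftrightarrow>
     (\<exists>\<eta>. (\<forall>a \<in> Obj C. is_isomorphism D (F\<^sub>o a) (G\<^sub>o a) (\<eta> a)) \<and>
          (\<forall>a \<in> Obj C. \<forall>b \<in> Obj C. \<forall>f \<in> Hom C a b.
             Comp D (F\<^sub>o a) (F\<^sub>o b) (G\<^sub>o b) (F\<^sub>m a b f) (\<eta> b) =
             Comp D (F\<^sub>o a) (G\<^sub>o a) (G\<^sub>o b) (\<eta> a) (G\<^sub>m a b f)))"

definition equivalent_categories :: "('o, 'm) cat \<Rightarrow> ('o2, 'm2) cat \<Rightarrow> bool"
  where "equivalent_categories C D \<longleftrightarrow>
     (\<exists>F\<^sub>o F\<^sub>m G\<^sub>o G\<^sub>m. is_functor C D F\<^sub>o F\<^sub>m \<and> is_functor D C G\<^sub>o G\<^sub>m \<and>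
        naturally_isomorphic C C (\<lambda>a. G\<^sub>o (F\<^sub>o a)) (\<lambda>a b f. G\<^sub>m (F\<^sub>o a) (F\<^sub>o b) (F\<^sub>m a b f))
          (\<lambda>a. a) (\<lambda>a b f. f) \<and>
        naturally_isomorphic D D (\<lambda>x. F\<^sub>o (G\<^sub>o x)) (\<lambda>x y g. F\<^sub>m (G\<^sub>o x) (G\<^sub>o y) (G\<^sub>m x y g))
          (\<lambda>x. x) (\<lambda>x y g. g))"


section \<open>The universe of modules\<close>

text \<open>
  ``All modules'' means: all modules whose carrier belongs to a fixed universe \<open>\<U>\<close>, a collection
  of subsets of some type.  Only two closure properties are demanded: \<open>\<U>\<close> is closed under passing
  to sets of at most the same cardinality and, up to bijection, under countable powers.  Examples
  are the sets of cardinality below an uncountable inaccessible cardinal (that is, the small sets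
  of a Grothendieck universe), but also \<^term>\<open>UNIV :: 'x set set\<close> whenever \<open>'x\<close> has at least as
  many elements as \<open>nat \<Rightarrow> 'x\<close>.
\<close>

definition module_universe :: "'x set set \<Rightarrow> bool"
  where "module_universe \<U> \<longleftrightarrow>
     (\<forall>A \<in> \<U>. \<forall>B. B \<lesssim> A \<longrightarrow> B \<in> \<U>) \<and>
     (\<forall>A \<in> \<U>. \<exists>B \<in> \<U>. (UNIV :: nat set) \<rightarrow>\<^sub>E A \<lesssim> B)"

definition small_in :: "'a set \<Rightarrow> 'x set set \<Rightarrow> bool"
  where "small_in X \<U> \<longleftrightarrow> (\<exists>A \<in> \<U>. X \<lesssim> A)"

definition LMod :: "'x set set \<Rightarrow> ('t, 'q) ring_scheme \<Rightarrow> (('t, 'x) module, 'x \<Rightarrow> 'x) cat"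
  where "LMod \<U> T = \<lparr>Obj = {M. left_module T M \<and> carrier M \<in> \<U>}, Hom = mod_hom T,
     Id = (\<lambda>M. \<lambda>x \<in> carrier M. x), Comp = (\<lambda>L M N f g. compose (carrier L) g f)\<rparr>"

definition RMod :: "'x set set \<Rightarrow> ('t, 'q) ring_scheme \<Rightarrow> (('t, 'x) module, 'x \<Rightarrow> 'x) cat"
  where "RMod \<U> T = \<lparr>Obj = {M. right_module T M \<and> carrier M \<in> \<U>}, Hom = mod_hom T,
     Id = (\<lambda>M. \<lambda>x \<in> carrier M. x), Comp = (\<lambda>L M N f g. compose (carrier L) g f)\<rparr>"


section \<open>Bimaps and the adjoint category\<close>

definition bimap ::
    "('r, 'p) ring_scheme \<Rightarrow> ('s, 'q) ring_scheme \<Rightarrow> ('r, 's, 'w, 'c) bimodule_scheme \<Rightarrow>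
     ('r, 'u) module \<Rightarrow> ('s, 'v) module \<Rightarrow> ('u \<Rightarrow> 'v \<Rightarrow> 'w) \<Rightarrow> bool"
  where "bimap R S W U V B \<longleftrightarrow>
     (\<forall>u \<in> carrier U. \<forall>v \<in> carrier V. B u v \<in> carrier W) \<and>
     (\<forall>u \<in> carrier U. \<forall>u' \<in> carrier U. \<forall>v \<in> carrier V. B (u \<oplus>\<^bsub>U\<^esub> u') v = B u v \<oplus>\<^bsub>W\<^esub> B u' v) \<and>
     (\<forall>u \<in> carrier U. \<forall>v \<in> carrier V. \<forall>v' \<in> carrier V. B u (v \<oplus>\<^bsub>V\<^esub> v') = B u v \<oplus>\<^bsub>W\<^esub> B u v') \<and>
     (\<forall>r \<in> carrier R. \<forall>u \<in> carrier U. \<forall>v \<in> carrier V. B (r \<odot>\<^bsub>U\<^esub> u) v = r \<odot>\<^bsub>W\<^esub> B u v) \<and>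
     (\<forall>s \<in> carrier S. \<forall>u \<in> carrier U. \<forall>v \<in> carrier V. B u (s \<odot>\<^bsub>V\<^esub> v) = B u v \<odot>\<^sub>r\<^bsub>W\<^esub> s)"

text \<open>
  An object of the adjoint category is a triple \<open>(U, V, B)\<close>.  The values of \<open>B\<close> outside
  \<^term>\<open>carrier U \<times> carrier V\<close> are irrelevant: objects differing only there are isomorphic.
\<close>

definition Adj ::
    "'x set set \<Rightarrow> ('r, 'p) ring_scheme \<Rightarrow> ('s, 'q) ring_scheme \<Rightarrow> ('r, 's, 'w, 'c) bimodule_scheme \<Rightarrow>
     (('r, 'x) module \<times> ('s, 'x) module \<times> ('x \<Rightarrow> 'x \<Rightarrow> 'w), ('x \<Rightarrow> 'x) \<times> ('x \<Rightarrow> 'x)) cat"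
  where "Adj \<U> R S W = \<lparr>
     Obj = {(U, V, B). left_module R U \<and> right_module S V \<and> carrier U \<in> \<U> \<and> carrier V \<in> \<U> \<and>
        bimap R S W U V B},
     Hom = (\<lambda>(U, V, B) (U', V', C). {(\<mu>, \<nu>). \<mu> \<in> mod_hom R U U' \<and> \<nu> \<in> mod_hom S V' V \<and>
        (\<forall>u \<in> carrier U. \<forall>v' \<in> carrier V'. C (\<mu> u) v' = B u (\<nu> v'))}),
     Id = (\<lambda>(U, V, B). (\<lambda>u \<in> carrier U. u, \<lambda>v \<in> carrier V. v)),
     Comp = (\<lambda>(U, V, B) (U', V', C) (U'', V'', D) (\<mu>, \<nu>) (\<mu>', \<nu>').
        (compose (carrier U) \<mu>' \<mu>, compose (carrier V'') \<nu> \<nu>'))\<rparr>"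


section \<open>Sanity checks\<close>

lemma mod_hom_Id:
  assumes "abelian_group M" "\<And>a x. a \<in> carrier R \<Longrightarrow> x \<in> carrier M \<Longrightarrow> a \<odot>\<^bsub>M\<^esub> x \<in> carrier M"
  shows "(\<lambda>x \<in> carrier M. x) \<in> mod_hom R M M"
proof -
  interpret abelian_group M by fact
  show ?thesis using assms(2) by (auto simp: mod_hom_def)
qed

lemma mod_hom_comp:
  assumes "abelian_group L" "\<And>a x. a \<in> carrier R \<Longrightarrow> x \<in> carrier L \<Longrightarrow> a \<odot>\<^bsub>L\<^esub> x \<in> carrier L"
    and "f \<in> mod_hom R L M" "g \<in> mod_hom R M N"
  shows "compose (carrier L) g f \<in> mod_hom R L N"
proof -
  interpret abelian_group L by fact
  have f: "f x \<in> carrier M" if "x \<in> carrier L" for x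
    using assms(3) that by (auto simp: mod_hom_def)
  have g: "g x \<in> carrier N" if "x \<in> carrier M" for x
    using assms(4) that by (auto simp: mod_hom_def)
  show ?thesis using assms(2-4) f g by (simp add: mod_hom_def compose_def)
qed

lemma mod_hom_extensional: "f \<in> mod_hom R M N \<Longrightarrow> f \<in> extensional (carrier M)"
  by (auto simp: mod_hom_def PiE_def)

lemma mod_hom_funcset: "f \<in> mod_hom R M N \<Longrightarrow> f \<in> carrier M \<rightarrow> carrier N"
  by (auto simp: mod_hom_def PiE_def)

lemma mod_hom_closed: "f \<in> mod_hom R M N \<Longrightarrow> x \<in> carrier M \<Longrightarrow> f x \<in> carrier N"
  by (auto simp: mod_hom_def)

lemmas mod_hom_simps =
  mod_hom_Id mod_hom_comp compose_Id[OF mod_hom_funcset mod_hom_extensional]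
  Id_compose[OF mod_hom_funcset mod_hom_extensional]

lemma left_module_basics:
  assumes "left_module R M"
  shows "abelian_group M" "\<And>a x. a \<in> carrier R \<Longrightarrow> x \<in> carrier M \<Longrightarrow> a \<odot>\<^bsub>M\<^esub> x \<in> carrier M"
  using assms by (auto simp: left_module_def left_module_axioms_def)

lemma right_module_basics:
  assumes "right_module R M"
  shows "abelian_group M" "\<And>a x. a \<in> carrier R \<Longrightarrow> x \<in> carrier M \<Longrightarrow> a \<odot>\<^bsub>M\<^esub> x \<in> carrier M"
  using assms by (auto simp: right_module_def right_module_axioms_def)

lemma category_LMod: "category (LMod \<U> T)"
  unfolding category_def LMod_def
  by (auto simp: mod_hom_simps left_module_basics compose_assoc[OF mod_hom_funcset])

lemma category_RMod: "category (RMod \<U> T)"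
  unfolding category_def RMod_def
  by (auto simp: mod_hom_simps right_module_basics compose_assoc[OF mod_hom_funcset])

lemma category_op_cat: "category C \<Longrightarrow> category (op_cat C)"
  by (simp add: category_def op_cat_def)

lemma category_Adj: "category (Adj \<U> R S W)"
  unfolding category_def Adj_def
  by (auto simp: mod_hom_simps left_module_basics right_module_basics
      compose_assoc[OF mod_hom_funcset] mod_hom_closed compose_eq)

text \<open>Universes exist over arbitrarily large types, such as \<^typ>\<open>nat \<Rightarrow> 'a\<close>.\<close>

lemma module_universe_UNIV:
  assumes "(UNIV :: (nat \<Rightarrow> 'x) set) \<lesssim> (UNIV :: 'x set)"
  shows "module_universe (UNIV :: 'x set set)"
  unfolding module_universe_def using assms
  by (metis UNIV_I lepoll_trans subset_UNIV subset_imp_lepoll)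

lemma module_universe_nat_fun: "module_universe (UNIV :: (nat \<Rightarrow> 'a) set set)"
proof (rule module_universe_UNIV)
  let ?g = "\<lambda>(f :: nat \<Rightarrow> nat \<Rightarrow> 'a) n. case from_nat n of (i, j :: nat) \<Rightarrow> f (i :: nat) j"
  have "inj ?g"
  proof (intro injI ext)
    fix f f' :: "nat \<Rightarrow> nat \<Rightarrow> 'a" and i j :: nat
    assume "?g f = ?g f'"
    from fun_cong[OF this, of "to_nat (i, j)"] show "f i j = f' i j" by simp
  qed
  then show "(UNIV :: (nat \<Rightarrow> nat \<Rightarrow> 'a) set) \<lesssim> (UNIV :: (nat \<Rightarrow> 'a) set)"
    unfolding lepoll_def by blast
qed

end

theory Submission
  imports Defs
begin

text \<open>
  The adjoint category contains the left \<open>R\<close>-modules covariantly, as the bimaps \<open>(U, 0, 0)\<close>, and the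
  right \<open>S\<close>-modules contravariantly, as the bimaps \<open>(0, V, 0)\<close>.  It is therefore too symmetric to
  be a category of modules, for in a category of modules coproducts and products behave
  differently: the canonical map from a countable copower to the corresponding power, the
  inclusion of a direct sum into a direct product, is always monic.

  In the adjoint category this fails.  Since \<open>V \<mapsto> (0, V, 0)\<close> reverses arrows, the sequence module
  \<open>P\<close> over \<open>S\<close> gives a copower of \<open>(0, S, 0)\<close>.  Its canonical projections are the embeddings of
  \<open>S\<close> into the coordinates of \<open>P\<close>, and these cannot tell the quotient map of \<open>P\<close> by the sequences of
  finite support from the zero map; as \<open>1 \<noteq> 0\<close> in \<open>S\<close>, these two maps differ.  The sequence module
  over \<open>R\<close> does the same in the opposite of the adjoint category.

  The predicate \<open>lossy_copower\<close> captures this phenomenon in terms that every equivalence preserves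
  (\<open>lossy_copower_weak_equivalence\<close>), additive or not.  A category of left modules has no lossy
  copower (\<open>LMod_not_lossy_copower\<close>), whereas the adjoint category and its opposite do
  (\<open>Adj_lossy_copower\<close>, \<open>op_cat_Adj_lossy_copower\<close>).  An equivalence with the opposite of a module
  category is the same as one of the opposite of the adjoint category with the module category,
  and right modules are left modules over the opposite ring.
\<close>

section \<open>Lossy copowers and equivalences\<close>

text \<open>
  Think of \<open>P\<close> as a copower of countably many copies of \<open>A\<close> with injections \<open>i n\<close>, and of \<open>p n\<close>
  as the projections that the zero morphism \<open>z\<close> provides.  Only one consequence of the universal
  property is kept, that the injections are jointly epic; absorption characterizes \<open>z\<close> without
  reference to an additive structure, which a functor need not respect.  The copower is lossy if
  the projections are not jointly monic, as witnessed by \<open>f \<noteq> g\<close>.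
\<close>

definition lossy_copower ::
    "('o, 'm) cat \<Rightarrow> 'o \<Rightarrow> 'o \<Rightarrow> 'o \<Rightarrow> 'm \<Rightarrow> (nat \<Rightarrow> 'm) \<Rightarrow> (nat \<Rightarrow> 'm) \<Rightarrow> 'm \<Rightarrow> 'm \<Rightarrow> bool"
  where "lossy_copower C A P K z i p f g \<longleftrightarrow>
     A \<in> Obj C \<and> P \<in> Obj C \<and> K \<in> Obj C \<and> z \<in> Hom C A A \<and>
     (\<forall>n. i n \<in> Hom C A P) \<and> (\<forall>n. p n \<in> Hom C P A) \<and>
     (\<forall>e \<in> Hom C A A. Comp C A A A e z = z) \<and>
     (\<forall>m n. Comp C A P A (i m) (p n) = (if m = n then Id C A else z)) \<and>
     (\<forall>X \<in> Obj C. \<forall>h \<in> Hom C P X. \<forall>h' \<in> Hom C P X.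
        (\<forall>n. Comp C A P X (i n) h = Comp C A P X (i n) h') \<longrightarrow> h = h') \<and>
     f \<in> Hom C K P \<and> g \<in> Hom C K P \<and> f \<noteq> g \<and>
     (\<forall>n. Comp C K P A f (p n) = Comp C K P A g (p n))"

lemma lossy_copower_jointly_epic:
  assumes "lossy_copower C A P K z i p f g" "X \<in> Obj C" "h \<in> Hom C P X" "h' \<in> Hom C P X"
    "\<And>n. Comp C A P X (i n) h = Comp C A P X (i n) h'"
  shows "h = h'"
  using assms unfolding lossy_copower_def by simp

text \<open>
  A fully faithful and essentially surjective functor.  Unlike a functor with a chosen
  quasi-inverse, it passes to opposite categories by a mere swap of arguments.
\<close>

definition weak_equivalence ::
    "('o, 'm) cat \<Rightarrow> ('o2, 'm2) cat \<Rightarrow> ('o \<Rightarrow> 'o2) \<Rightarrow> (['o, 'o, 'm] \<Rightarrow> 'm2) \<Rightarrow> bool"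
  where "weak_equivalence C D F\<^sub>o F\<^sub>m \<longleftrightarrow> is_functor C D F\<^sub>o F\<^sub>m \<and>
     (\<forall>a \<in> Obj C. \<forall>b \<in> Obj C. bij_betw (F\<^sub>m a b) (Hom C a b) (Hom D (F\<^sub>o a) (F\<^sub>o b))) \<and>
     (\<forall>x \<in> Obj D. \<exists>a \<in> Obj C. \<exists>f. is_isomorphism D (F\<^sub>o a) x f)"

lemma
  assumes "category C"
  shows cat_Id: "a \<in> Obj C \<Longrightarrow> Id C a \<in> Hom C a a"
    and cat_Comp: "\<lbrakk>f \<in> Hom C a b; g \<in> Hom C b c; a \<in> Obj C; b \<in> Obj C; c \<in> Obj C\<rbrakk>
      \<Longrightarrow> Comp C a b c f g \<in> Hom C a c"
    and cat_Id_left: "\<lbrakk>f \<in> Hom C a b; a \<in> Obj C; b \<in> Obj C\<rbrakk> \<Longrightarrow> Comp C a a b (Id C a) f = f"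
    and cat_Id_right: "\<lbrakk>f \<in> Hom C a b; a \<in> Obj C; b \<in> Obj C\<rbrakk> \<Longrightarrow> Comp C a b b f (Id C b) = f"
    and cat_assoc: "\<lbrakk>f \<in> Hom C a b; g \<in> Hom C b c; h \<in> Hom C c d;
        a \<in> Obj C; b \<in> Obj C; c \<in> Obj C; d \<in> Obj C\<rbrakk>
      \<Longrightarrow> Comp C a c d (Comp C a b c f g) h = Comp C a b d f (Comp C b c d g h)"
  using assms unfolding category_def by blast+

lemma isomorphism_epic:
  assumes C: "category C" and obj: "a \<in> Obj C" "b \<in> Obj C" "c \<in> Obj C"
    and iso: "is_isomorphism C a b e"
    and f: "f \<in> Hom C b c" and g: "g \<in> Hom C b c"
    and eq: "Comp C a b c e f = Comp C a b c e g"
  shows "f = g"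
proof -
  obtain d where e: "e \<in> Hom C a b" and d: "d \<in> Hom C b a" and de: "Comp C b a b d e = Id C b"
    using iso unfolding is_isomorphism_def by blast
  have "h = Comp C b a c d (Comp C a b c e h)" if "h \<in> Hom C b c" for h
    using cat_assoc[OF C d e that obj(2,1,2,3)] cat_Id_left[OF C that obj(2,3)] de by simp
  with f g eq show ?thesis by metis
qed

lemma isomorphism_monic:
  assumes C: "category C" and obj: "a \<in> Obj C" "b \<in> Obj C" "c \<in> Obj C"
    and iso: "is_isomorphism C b c e"
    and f: "f \<in> Hom C a b" and g: "g \<in> Hom C a b"
    and eq: "Comp C a b c f e = Comp C a b c g e"
  shows "f = g"
proof -
  obtain d where e: "e \<in> Hom C b c" and d: "d \<in> Hom C c b" and ed: "Comp C b c b e d = Id C b"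
    using iso unfolding is_isomorphism_def by blast
  have "h = Comp C a c b (Comp C a b c h e) d" if "h \<in> Hom C a b" for h
    using cat_assoc[OF C that e d obj(1,2,3,2)] cat_Id_right[OF C that obj(1,2)] ed by simp
  with f g eq show ?thesis by metis
qed

text \<open>
  By naturality \<open>f\<close> can be recovered from \<open>G (F f)\<close> by composing with the components of the
  isomorphism, which cancel.
\<close>

lemma functor_faithful_if_retract:
  assumes C: "category C" and F: "is_functor C D F\<^sub>o F\<^sub>m" and G: "is_functor D C G\<^sub>o G\<^sub>m"
    and nat: "naturally_isomorphic C C (\<lambda>a. G\<^sub>o (F\<^sub>o a))
      (\<lambda>a b f. G\<^sub>m (F\<^sub>o a) (F\<^sub>o b) (F\<^sub>m a b f)) (\<lambda>a. a) (\<lambda>a b f. f)"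
    and ab: "a \<in> Obj C" "b \<in> Obj C"
  shows "inj_on (F\<^sub>m a b) (Hom C a b)"
proof (rule inj_onI)
  fix f g assume f: "f \<in> Hom C a b" and g: "g \<in> Hom C a b" and eq: "F\<^sub>m a b f = F\<^sub>m a b g"
  obtain \<eta> where iso: "\<forall>a \<in> Obj C. is_isomorphism C (G\<^sub>o (F\<^sub>o a)) a (\<eta> a)"
    and sq: "\<forall>a \<in> Obj C. \<forall>b \<in> Obj C. \<forall>f \<in> Hom C a b.
      Comp C (G\<^sub>o (F\<^sub>o a)) (G\<^sub>o (F\<^sub>o b)) b (G\<^sub>m (F\<^sub>o a) (F\<^sub>o b) (F\<^sub>m a b f)) (\<eta> b) =
      Comp C (G\<^sub>o (F\<^sub>o a)) a b (\<eta> a) f"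
    using nat unfolding naturally_isomorphic_def by blast
  have "G\<^sub>o (F\<^sub>o a) \<in> Obj C" using F G ab unfolding is_functor_def by blast
  moreover have "Comp C (G\<^sub>o (F\<^sub>o a)) a b (\<eta> a) f = Comp C (G\<^sub>o (F\<^sub>o a)) a b (\<eta> a) g"
    using sq f g ab eq by metis
  ultimately show "f = g" using isomorphism_epic[OF C _ ab _ f g] iso ab by blast
qed

text \<open>
  Both functors of an equivalence are faithful by the previous lemma.  For fullness of \<open>F\<close>, conjugate
  \<open>G h\<close> by the natural isomorphism \<open>\<eta>\<close> to get \<open>f\<close>; then \<open>G (F f) = G h\<close> by naturality,
  and \<open>G\<close> is faithful.
\<close>

lemma equivalent_categories_weak_equivalence:
  assumes C: "category C" and D: "category D" and eq: "equivalent_categories C D"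
  shows "\<exists>F\<^sub>o F\<^sub>m. weak_equivalence C D F\<^sub>o F\<^sub>m"
proof -
  obtain F\<^sub>o F\<^sub>m G\<^sub>o G\<^sub>m where F: "is_functor C D F\<^sub>o F\<^sub>m" and G: "is_functor D C G\<^sub>o G\<^sub>m"
    and GF: "naturally_isomorphic C C (\<lambda>a. G\<^sub>o (F\<^sub>o a))
      (\<lambda>a b f. G\<^sub>m (F\<^sub>o a) (F\<^sub>o b) (F\<^sub>m a b f)) (\<lambda>a. a) (\<lambda>a b f. f)"
    and FG: "naturally_isomorphic D D (\<lambda>x. F\<^sub>o (G\<^sub>o x))
      (\<lambda>x y g. F\<^sub>m (G\<^sub>o x) (G\<^sub>o y) (G\<^sub>m x y g)) (\<lambda>x. x) (\<lambda>x y g. g)"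
    using eq unfolding equivalent_categories_def by blast
  have Fo: "F\<^sub>o a \<in> Obj D" if "a \<in> Obj C" for a using F that unfolding is_functor_def by blast
  have Go: "G\<^sub>o x \<in> Obj C" if "x \<in> Obj D" for x using G that unfolding is_functor_def by blast
  have Fm: "F\<^sub>m a b f \<in> Hom D (F\<^sub>o a) (F\<^sub>o b)" if "f \<in> Hom C a b" "a \<in> Obj C" "b \<in> Obj C" for a b f
    using F that unfolding is_functor_def by blast
  have Gm: "G\<^sub>m x y g \<in> Hom C (G\<^sub>o x) (G\<^sub>o y)" if "g \<in> Hom D x y" "x \<in> Obj D" "y \<in> Obj D" for x y g
    using G that unfolding is_functor_def by blast
  obtain \<eta> where iso: "\<And>a. a \<in> Obj C \<Longrightarrow> is_isomorphism C (G\<^sub>o (F\<^sub>o a)) a (\<eta> a)"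
    and sq: "\<And>a b f. \<lbrakk>a \<in> Obj C; b \<in> Obj C; f \<in> Hom C a b\<rbrakk> \<Longrightarrow>
      Comp C (G\<^sub>o (F\<^sub>o a)) (G\<^sub>o (F\<^sub>o b)) b (G\<^sub>m (F\<^sub>o a) (F\<^sub>o b) (F\<^sub>m a b f)) (\<eta> b) =
      Comp C (G\<^sub>o (F\<^sub>o a)) a b (\<eta> a) f"
    using GF unfolding naturally_isomorphic_def by blast
  have full: "\<exists>f \<in> Hom C a b. F\<^sub>m a b f = h"
    if ab: "a \<in> Obj C" "b \<in> Obj C" and h: "h \<in> Hom D (F\<^sub>o a) (F\<^sub>o b)" for a b h
  proof -
    let ?a = "G\<^sub>o (F\<^sub>o a)" and ?b = "G\<^sub>o (F\<^sub>o b)"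
    have obj: "?a \<in> Obj C" "?b \<in> Obj C" using ab Fo Go by auto
    have Gh: "G\<^sub>m (F\<^sub>o a) (F\<^sub>o b) h \<in> Hom C ?a ?b" using Gm h ab Fo by auto
    have \<eta>: "\<eta> a \<in> Hom C ?a a" "\<eta> b \<in> Hom C ?b b"
      using iso ab unfolding is_isomorphism_def by auto
    obtain \<theta> where \<theta>: "\<theta> \<in> Hom C a ?a" "Comp C ?a a ?a (\<eta> a) \<theta> = Id C ?a"
      using iso[OF ab(1)] unfolding is_isomorphism_def by blast
    have k: "Comp C ?a ?b b (G\<^sub>m (F\<^sub>o a) (F\<^sub>o b) h) (\<eta> b) \<in> Hom C ?a b" (is "?k \<in> _")
      using cat_Comp[OF C Gh \<eta>(2)] obj ab by auto
    define f where "f = Comp C a ?a b \<theta> ?k"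
    have f: "f \<in> Hom C a b" unfolding f_def using cat_Comp[OF C \<theta>(1) k] obj ab by auto
    have "Comp C ?a a b (\<eta> a) f = ?k"
      unfolding f_def using cat_assoc[OF C \<eta>(1) \<theta>(1) k] cat_Id_left[OF C k] \<theta>(2) obj ab by auto
    then have "Comp C ?a ?b b (G\<^sub>m (F\<^sub>o a) (F\<^sub>o b) (F\<^sub>m a b f)) (\<eta> b) = ?k"
      using sq[OF ab f] by simp
    then have "G\<^sub>m (F\<^sub>o a) (F\<^sub>o b) (F\<^sub>m a b f) = G\<^sub>m (F\<^sub>o a) (F\<^sub>o b) h"
      using isomorphism_monic[OF C obj(1) obj(2) ab(2) iso[OF ab(2)] Gm[OF Fm[OF f]] Gh] ab Fo by blast
    then have "F\<^sub>m a b f = h"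
      using functor_faithful_if_retract[OF D G F FG Fo[OF ab(1)] Fo[OF ab(2)]] Fm[OF f ab] h
      by (auto dest: inj_onD)
    with f show ?thesis by blast
  qed
  have "bij_betw (F\<^sub>m a b) (Hom C a b) (Hom D (F\<^sub>o a) (F\<^sub>o b))" if "a \<in> Obj C" "b \<in> Obj C" for a b
    unfolding bij_betw_def
    using functor_faithful_if_retract[OF C F G GF that] full[OF that] Fm that by blast
  moreover have "\<exists>a \<in> Obj C. \<exists>f. is_isomorphism D (F\<^sub>o a) x f" if "x \<in> Obj D" for x
    using FG that Go unfolding naturally_isomorphic_def by blast
  ultimately show ?thesis unfolding weak_equivalence_def using F by blast
qed

lemma op_cat_simps:
  "Obj (op_cat C) = Obj C" "Hom (op_cat C) a b = Hom C b a" "Id (op_cat C) = Id C"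
  "Comp (op_cat C) a b c f g = Comp C c b a g f"
  by (simp_all add: op_cat_def)

lemma op_cat_op_cat [simp]: "op_cat (op_cat C) = C"
  by (simp add: op_cat_def)

lemma weak_equivalence_op_cat:
  assumes F: "weak_equivalence C D F\<^sub>o F\<^sub>m"
  shows "weak_equivalence (op_cat C) (op_cat D) F\<^sub>o (\<lambda>a b. F\<^sub>m b a)"
  unfolding weak_equivalence_def
proof (intro conjI ballI)
  show "is_functor (op_cat C) (op_cat D) F\<^sub>o (\<lambda>a b. F\<^sub>m b a)"
    using F unfolding weak_equivalence_def is_functor_def op_cat_def by simp
next
  fix a b assume "a \<in> Obj (op_cat C)" "b \<in> Obj (op_cat C)"
  then show "bij_betw (F\<^sub>m b a) (Hom (op_cat C) a b) (Hom (op_cat D) (F\<^sub>o a) (F\<^sub>o b))"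
    using F unfolding weak_equivalence_def by (simp add: op_cat_def)
next
  fix x assume "x \<in> Obj (op_cat D)"
  then obtain a f where "a \<in> Obj C" "is_isomorphism D (F\<^sub>o a) x f"
    using F unfolding weak_equivalence_def by (auto simp: op_cat_def)
  then show "\<exists>a \<in> Obj (op_cat C). \<exists>f. is_isomorphism (op_cat D) (F\<^sub>o a) x f"
    unfolding is_isomorphism_def op_cat_def by auto
qed

text \<open>
  Fullness and faithfulness transport the equations and absorption.  Essential surjectivity is
  needed for joint epicity alone: a morphism out of \<open>F P\<close> may have a target outside the image of
  \<open>F\<close>, and is first composed with an isomorphism into that image.
\<close>

lemma lossy_copower_weak_equivalence:
  assumes C: "category C" and D: "category D"
    and F: "weak_equivalence C D F\<^sub>o F\<^sub>m" and lossy: "lossy_copower C A P K z i p f g"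
  shows "lossy_copower D (F\<^sub>o A) (F\<^sub>o P) (F\<^sub>o K) (F\<^sub>m A A z)
    (\<lambda>n. F\<^sub>m A P (i n)) (\<lambda>n. F\<^sub>m P A (p n)) (F\<^sub>m K P f) (F\<^sub>m K P g)"
proof -
  have obj: "A \<in> Obj C" "P \<in> Obj C" "K \<in> Obj C"
    and z: "z \<in> Hom C A A" and fg: "f \<in> Hom C K P" "g \<in> Hom C K P" "f \<noteq> g"
    and i: "\<And>n :: nat. i n \<in> Hom C A P" and p: "\<And>n. p n \<in> Hom C P A"
    and ez: "\<And>e. e \<in> Hom C A A \<Longrightarrow> Comp C A A A e z = z"
    and ip: "\<And>m n. Comp C A P A (i m) (p n) = (if m = n then Id C A else z)"
    and epi: "\<And>X h h'. \<lbrakk>X \<in> Obj C; h \<in> Hom C P X; h' \<in> Hom C P X;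
      \<And>n. Comp C A P X (i n) h = Comp C A P X (i n) h'\<rbrakk> \<Longrightarrow> h = h'"
    and lose: "\<And>n. Comp C K P A f (p n) = Comp C K P A g (p n)"
    using lossy unfolding lossy_copower_def by simp_all
  have Fo: "F\<^sub>o a \<in> Obj D" if "a \<in> Obj C" for a
    using F that unfolding weak_equivalence_def is_functor_def by blast
  have bij: "bij_betw (F\<^sub>m a b) (Hom C a b) (Hom D (F\<^sub>o a) (F\<^sub>o b))" if "a \<in> Obj C" "b \<in> Obj C" for a b
    using F that unfolding weak_equivalence_def by blast
  have Fm: "F\<^sub>m a b f \<in> Hom D (F\<^sub>o a) (F\<^sub>o b)" if "f \<in> Hom C a b" "a \<in> Obj C" "b \<in> Obj C" for a b f
    using F that unfolding weak_equivalence_def is_functor_def by blast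
  have inj: "f = g" if "F\<^sub>m a b f = F\<^sub>m a b g" "f \<in> Hom C a b" "g \<in> Hom C a b" "a \<in> Obj C" "b \<in> Obj C"
    for a b f g using bij that unfolding bij_betw_def inj_on_def by blast
  have full: "\<exists>f \<in> Hom C a b. F\<^sub>m a b f = h"
    if "h \<in> Hom D (F\<^sub>o a) (F\<^sub>o b)" "a \<in> Obj C" "b \<in> Obj C" for a b h
    using bij[OF that(2,3)] that(1) by (metis bij_betw_imp_surj_on imageE)
  have Id: "F\<^sub>m a a (Id C a) = Id D (F\<^sub>o a)" if "a \<in> Obj C" for a
    using F that unfolding weak_equivalence_def is_functor_def by blast
  have comp: "Comp D (F\<^sub>o a) (F\<^sub>o b) (F\<^sub>o c) (F\<^sub>m a b f) (F\<^sub>m b c g) = F\<^sub>m a c (Comp C a b c f g)"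
    if "f \<in> Hom C a b" "g \<in> Hom C b c" "a \<in> Obj C" "b \<in> Obj C" "c \<in> Obj C" for a b c f g
    using F that unfolding weak_equivalence_def is_functor_def by auto
  let ?A = "F\<^sub>o A" and ?P = "F\<^sub>o P" and ?K = "F\<^sub>o K"
  have epi': "h = h'" if X: "X \<in> Obj D" and h: "h \<in> Hom D ?P X" "h' \<in> Hom D ?P X"
    and eq: "\<And>n. Comp D ?A ?P X (F\<^sub>m A P (i n)) h = Comp D ?A ?P X (F\<^sub>m A P (i n)) h'" for X h h'
  proof -
    obtain Y e where Y: "Y \<in> Obj C" and "is_isomorphism D (F\<^sub>o Y) X e"
      using F X unfolding weak_equivalence_def by blast
    then obtain d where d: "is_isomorphism D X (F\<^sub>o Y) d" unfolding is_isomorphism_def by blast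
    then have dX: "d \<in> Hom D X (F\<^sub>o Y)" unfolding is_isomorphism_def by blast
    obtain k k' where k: "k \<in> Hom C P Y" "F\<^sub>m P Y k = Comp D ?P X (F\<^sub>o Y) h d"
      and k': "k' \<in> Hom C P Y" "F\<^sub>m P Y k' = Comp D ?P X (F\<^sub>o Y) h' d"
      using full cat_Comp[OF D _ dX] h X Y obj Fo by metis
    have "Comp C A P Y (i n) k = Comp C A P Y (i n) k'" for n
    proof (rule inj)
      have "F\<^sub>m A Y (Comp C A P Y (i n) k) = Comp D ?A ?P (F\<^sub>o Y) (F\<^sub>m A P (i n)) (F\<^sub>m P Y k)"
        using comp i k obj Y by metis
      also have "\<dots> = Comp D ?A ?P (F\<^sub>o Y) (F\<^sub>m A P (i n)) (F\<^sub>m P Y k')"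
        unfolding k(2) k'(2) using eq cat_assoc[OF D Fm[OF i] _ dX] h obj X Y Fo by metis
      also have "\<dots> = F\<^sub>m A Y (Comp C A P Y (i n) k')" using comp i k' obj Y by metis
      finally show "F\<^sub>m A Y (Comp C A P Y (i n) k) = F\<^sub>m A Y (Comp C A P Y (i n) k')" .
    qed (use cat_Comp[OF C i] k k' obj Y in auto)
    then have "k = k'" using epi Y k k' by blast
    then show ?thesis using isomorphism_monic[OF D Fo[OF obj(2)] X Fo[OF Y] d h] k k' by simp
  qed
  have ez': "Comp D ?A ?A ?A e (F\<^sub>m A A z) = F\<^sub>m A A z" if "e \<in> Hom D ?A ?A" for e
    using full[OF that obj(1,1)] comp[OF _ z obj(1,1,1)] ez by metis
  have ip': "Comp D ?A ?P ?A (F\<^sub>m A P (i m)) (F\<^sub>m P A (p n)) = (if m = n then Id D ?A else F\<^sub>m A A z)"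
    for m n using comp[OF i p] ip Id obj by simp
  have lose': "Comp D ?K ?P ?A (F\<^sub>m K P f) (F\<^sub>m P A (p n)) = Comp D ?K ?P ?A (F\<^sub>m K P g) (F\<^sub>m P A (p n))"
    for n using comp[OF fg(1) p] comp[OF fg(2) p] lose obj by simp
  have ne: "F\<^sub>m K P f \<noteq> F\<^sub>m K P g" using inj fg obj by blast
  show ?thesis unfolding lossy_copower_def
    using Fo Fm obj z fg(1,2) i p ez' ip' epi' lose' ne by simp
qed

section \<open>Modules and their quotients\<close>

text \<open>
  Right modules are left modules over the opposite ring, so that all constructions are needed on
  one side only.
\<close>

definition op_ring :: "('r, 'p) ring_scheme \<Rightarrow> ('r, 'p) ring_scheme"
  where "op_ring R = R\<lparr>mult := \<lambda>a b. b \<otimes>\<^bsub>R\<^esub> a\<rparr>"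

lemma op_ring_simps [simp]:
  "carrier (op_ring R) = carrier R" "add (op_ring R) = add R" "zero (op_ring R) = zero R"
  "one (op_ring R) = one R" "a \<otimes>\<^bsub>op_ring R\<^esub> b = b \<otimes>\<^bsub>R\<^esub> a"
  by (simp_all add: op_ring_def)

lemma ring_op_ring:
  assumes "ring R" shows "ring (op_ring R)"
proof -
  interpret ring R by fact
  have "add_monoid (op_ring R) = add_monoid R" by simp
  then have "abelian_group (op_ring R)"
    using abelian_group_axioms
    by (simp add: abelian_group_def abelian_group_axioms_def abelian_monoid_def)
  moreover have "monoid (op_ring R)"
    by (rule monoidI) (auto simp: m_assoc)
  ultimately show ?thesis
    by (intro ringI) (auto simp: l_distr r_distr)
qed

lemma right_module_iff_left_module_op_ring:
  assumes "ring R" shows "right_module R M \<longleftrightarrow> left_module (op_ring R) M"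
  using assms ring_op_ring[OF assms]
  by (auto simp: left_module_def right_module_def left_module_axioms_def right_module_axioms_def)

lemma mod_hom_op_ring [simp]: "mod_hom (op_ring R) = mod_hom R"
  by (auto simp: mod_hom_def fun_eq_iff)

lemma RMod_eq_LMod_op_ring:
  assumes "ring T" shows "RMod \<U> T = LMod \<U> (op_ring T)"
  by (simp add: RMod_def LMod_def right_module_iff_left_module_op_ring[OF assms])

context left_module
begin

lemma smult_zero: assumes "a \<in> carrier R" shows "a \<odot>\<^bsub>M\<^esub> \<zero>\<^bsub>M\<^esub> = \<zero>\<^bsub>M\<^esub>"
proof -
  have "a \<odot>\<^bsub>M\<^esub> \<zero>\<^bsub>M\<^esub> \<oplus>\<^bsub>M\<^esub> a \<odot>\<^bsub>M\<^esub> \<zero>\<^bsub>M\<^esub> = a \<odot>\<^bsub>M\<^esub> \<zero>\<^bsub>M\<^esub>"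
    using smult_r_distr[OF assms M.zero_closed M.zero_closed] by simp
  then show ?thesis using smult_closed[OF assms M.zero_closed]
    by (metis M.add.l_cancel_one)
qed

lemma smult_zero_left: assumes "x \<in> carrier M" shows "\<zero> \<odot>\<^bsub>M\<^esub> x = \<zero>\<^bsub>M\<^esub>"
proof -
  have "\<zero> \<odot>\<^bsub>M\<^esub> x \<oplus>\<^bsub>M\<^esub> \<zero> \<odot>\<^bsub>M\<^esub> x = \<zero> \<odot>\<^bsub>M\<^esub> x"
    using smult_l_distr[OF R.zero_closed R.zero_closed assms] by simp
  then show ?thesis using smult_closed[OF R.zero_closed assms]
    by (metis M.add.l_cancel_one)
qed

end

text \<open>
  The structure induced on the image of a map \<open>\<phi>\<close> whose fibres form a congruence.  If \<open>\<phi>\<close> is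
  injective, this transports a module to another type; if \<open>\<phi>\<close> picks representatives of cosets,
  it is a quotient module whose carrier is a subset of the original one, and therefore belongs to
  every universe that contains it.
\<close>

definition image_module :: "('x \<Rightarrow> 'y) \<Rightarrow> ('r, 'x, 'c) module_scheme \<Rightarrow> ('r, 'y) module"
  where "image_module \<phi> M = \<lparr>carrier = \<phi> ` carrier M, mult = undefined, one = undefined,
     zero = \<phi> \<zero>\<^bsub>M\<^esub>,
     add = (\<lambda>x y. \<phi> (inv_into (carrier M) \<phi> x \<oplus>\<^bsub>M\<^esub> inv_into (carrier M) \<phi> y)),
     smult = (\<lambda>a x. \<phi> (a \<odot>\<^bsub>M\<^esub> inv_into (carrier M) \<phi> x))\<rparr>"

locale module_congruence = left_module R M for R (structure) and M (structure) +
  fixes \<phi> :: "'c \<Rightarrow> 'e"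
  assumes add_cong: "\<lbrakk>x \<in> carrier M; x' \<in> carrier M; y \<in> carrier M; y' \<in> carrier M;
      \<phi> x = \<phi> x'; \<phi> y = \<phi> y'\<rbrakk> \<Longrightarrow> \<phi> (x \<oplus>\<^bsub>M\<^esub> y) = \<phi> (x' \<oplus>\<^bsub>M\<^esub> y')"
    and smult_cong: "\<lbrakk>a \<in> carrier R; x \<in> carrier M; x' \<in> carrier M; \<phi> x = \<phi> x'\<rbrakk>
      \<Longrightarrow> \<phi> (a \<odot>\<^bsub>M\<^esub> x) = \<phi> (a \<odot>\<^bsub>M\<^esub> x')"
begin

lemma carrier_image_module: "carrier (image_module \<phi> M) = \<phi> ` carrier M"
  by (simp add: image_module_def)

lemma zero_image_module: "\<zero>\<^bsub>image_module \<phi> M\<^esub> = \<phi> \<zero>\<^bsub>M\<^esub>"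
  by (simp add: image_module_def)

lemma add_image_module:
  assumes "x \<in> carrier M" "y \<in> carrier M"
  shows "\<phi> x \<oplus>\<^bsub>image_module \<phi> M\<^esub> \<phi> y = \<phi> (x \<oplus>\<^bsub>M\<^esub> y)"
  unfolding image_module_def using assms
  by (auto intro!: add_cong simp: inv_into_into f_inv_into_f)

lemma smult_image_module:
  assumes "a \<in> carrier R" "x \<in> carrier M"
  shows "a \<odot>\<^bsub>image_module \<phi> M\<^esub> \<phi> x = \<phi> (a \<odot>\<^bsub>M\<^esub> x)"
  unfolding image_module_def using assms
  by (auto intro!: smult_cong simp: inv_into_into f_inv_into_f)

lemmas image_module_simps =
  carrier_image_module zero_image_module add_image_module smult_image_module

lemma left_module_image_module: "left_module R (image_module \<phi> M)"
proof -
  have "abelian_group (image_module \<phi> M)"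
  proof (rule abelian_groupI)
    fix x assume "x \<in> carrier (image_module \<phi> M)"
    then obtain u where u: "u \<in> carrier M" "x = \<phi> u" by (auto simp: image_module_simps)
    have "\<phi> (\<ominus>\<^bsub>M\<^esub> u) \<oplus>\<^bsub>image_module \<phi> M\<^esub> \<phi> u = \<zero>\<^bsub>image_module \<phi> M\<^esub>"
      using u by (simp add: image_module_simps M.l_neg)
    then show "\<exists>y \<in> carrier (image_module \<phi> M). y \<oplus>\<^bsub>image_module \<phi> M\<^esub> x = \<zero>\<^bsub>image_module \<phi> M\<^esub>"
      using u by (auto simp: carrier_image_module)
  qed (auto simp: image_module_simps M.a_ac)
  moreover have "left_module_axioms R (image_module \<phi> M)"
    by unfold_locales
      (auto simp: image_module_simps smult_closed smult_l_distr smult_r_distr smult_assoc smult_one)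
  ultimately show ?thesis unfolding left_module_def using R.ring_axioms by blast
qed

lemma mod_hom_to_image_module: "(\<lambda>x \<in> carrier M. \<phi> x) \<in> mod_hom R M (image_module \<phi> M)"
  by (auto simp: mod_hom_def image_module_simps smult_closed)

lemma mod_hom_from_image_module:
  assumes f: "f \<in> mod_hom R M N"
    and factors: "\<And>x y. \<lbrakk>x \<in> carrier M; y \<in> carrier M; \<phi> x = \<phi> y\<rbrakk> \<Longrightarrow> f x = f y"
  shows "\<exists>g \<in> mod_hom R (image_module \<phi> M) N. \<forall>x \<in> carrier M. g (\<phi> x) = f x"
proof -
  define g where "g = (\<lambda>y \<in> \<phi> ` carrier M. f (inv_into (carrier M) \<phi> y))"
  have g: "g (\<phi> x) = f x" if "x \<in> carrier M" for x
    using that unfolding g_def by (auto intro!: factors simp: inv_into_into f_inv_into_f)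
  have "g \<in> extensional (carrier (image_module \<phi> M))"
    by (simp add: g_def carrier_image_module)
  then have "g \<in> mod_hom R (image_module \<phi> M) N"
    using f by (auto simp: mod_hom_def image_module_simps g smult_closed PiE_def)
  with g show ?thesis by blast
qed

end

lemma mod_hom_add:
  "\<lbrakk>f \<in> mod_hom R M N; x \<in> carrier M; y \<in> carrier M\<rbrakk> \<Longrightarrow> f (x \<oplus>\<^bsub>M\<^esub> y) = f x \<oplus>\<^bsub>N\<^esub> f y"
  by (simp add: mod_hom_def)

lemma mod_hom_smult:
  "\<lbrakk>f \<in> mod_hom R M N; a \<in> carrier R; x \<in> carrier M\<rbrakk> \<Longrightarrow> f (a \<odot>\<^bsub>M\<^esub> x) = a \<odot>\<^bsub>N\<^esub> f x"
  by (simp add: mod_hom_def)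

lemma mod_hom_zero:
  assumes "abelian_group M" "abelian_group N" "f \<in> mod_hom R M N"
  shows "f \<zero>\<^bsub>M\<^esub> = \<zero>\<^bsub>N\<^esub>"
proof -
  interpret M: abelian_group M by fact
  interpret N: abelian_group N by fact
  show ?thesis
    using mod_hom_add[OF assms(3) M.zero_closed M.zero_closed] mod_hom_closed[OF assms(3) M.zero_closed]
    by (metis M.l_zero M.zero_closed N.add.l_cancel_one)
qed

lemma mod_hom_minus:
  assumes "abelian_group M" "abelian_group N" "f \<in> mod_hom R M N" "x \<in> carrier M" "y \<in> carrier M"
  shows "f (x \<ominus>\<^bsub>M\<^esub> y) = f x \<ominus>\<^bsub>N\<^esub> f y"
proof -
  interpret M: abelian_group M by fact
  interpret N: abelian_group N by fact
  have "f (x \<ominus>\<^bsub>M\<^esub> y) \<oplus>\<^bsub>N\<^esub> f y = f x"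
    using mod_hom_add[OF assms(3), of "x \<ominus>\<^bsub>M\<^esub> y" y] assms(4,5)
    by (simp add: M.minus_eq M.a_assoc M.l_neg)
  then show ?thesis using assms mod_hom_closed[OF assms(3)]
    by (metis M.minus_closed N.add.inv_solve_right N.minus_eq)
qed

lemma zero_mod_hom:
  assumes "left_module R M" "left_module R N"
  shows "(\<lambda>x \<in> carrier M. \<zero>\<^bsub>N\<^esub>) \<in> mod_hom R M N"
proof -
  interpret M: left_module R M by fact
  interpret N: left_module R N by fact
  show ?thesis by (auto simp: mod_hom_def M.smult_closed N.smult_zero)
qed

lemma mod_hom_eqI:
  assumes "f \<in> mod_hom R M N" "g \<in> mod_hom R M N" "\<And>x. x \<in> carrier M \<Longrightarrow> f x = g x"
  shows "f = g"
  using assms by (auto intro: extensionalityI mod_hom_extensional)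

text \<open>
  The quotient by \<open>H\<close>, with a chosen representative in place of each coset.
\<close>

lemma quotient_module:
  assumes M: "left_module R M" and sub: "H \<subseteq> carrier M" and zero: "\<zero>\<^bsub>M\<^esub> \<in> H"
    and add: "\<And>x y. \<lbrakk>x \<in> H; y \<in> H\<rbrakk> \<Longrightarrow> x \<oplus>\<^bsub>M\<^esub> y \<in> H"
    and smult: "\<And>a x. \<lbrakk>a \<in> carrier R; x \<in> H\<rbrakk> \<Longrightarrow> a \<odot>\<^bsub>M\<^esub> x \<in> H"
  shows "\<exists>(Q :: ('r, 'x) module) q. left_module R Q \<and> carrier Q \<subseteq> carrier (M :: ('r, 'x, 'c) module_scheme) \<and>
    q \<in> mod_hom R M Q \<and> (\<forall>x \<in> carrier M. q x = \<zero>\<^bsub>Q\<^esub> \<longleftrightarrow> x \<in> H)"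
proof -
  interpret M: left_module R M by fact
  have minus_zero: "x \<ominus>\<^bsub>M\<^esub> \<zero>\<^bsub>M\<^esub> = x" if "x \<in> carrier M" for x
    using that by (simp add: M.minus_eq)
  \<comment> \<open>Closure under scalars yields negatives, as \<open>(- 1) x = - x\<close>.\<close>
  have inv: "\<ominus>\<^bsub>M\<^esub> x \<in> H" if x: "x \<in> H" for x
  proof -
    have xM: "x \<in> carrier M" using x sub by blast
    have "(\<ominus>\<^bsub>R\<^esub> \<one>\<^bsub>R\<^esub>) \<odot>\<^bsub>M\<^esub> x \<oplus>\<^bsub>M\<^esub> x = (\<ominus>\<^bsub>R\<^esub> \<one>\<^bsub>R\<^esub> \<oplus>\<^bsub>R\<^esub> \<one>\<^bsub>R\<^esub>) \<odot>\<^bsub>M\<^esub> x"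
      using M.smult_l_distr[of "\<ominus>\<^bsub>R\<^esub> \<one>\<^bsub>R\<^esub>" "\<one>\<^bsub>R\<^esub>" x] xM by (simp add: M.smult_one)
    also have "\<dots> = \<zero>\<^bsub>M\<^esub>" using M.smult_zero_left[OF xM] by (simp add: M.R.l_neg)
    finally have "(\<ominus>\<^bsub>R\<^esub> \<one>\<^bsub>R\<^esub>) \<odot>\<^bsub>M\<^esub> x = \<ominus>\<^bsub>M\<^esub> x"
      using xM by (metis M.M.minus_equality M.R.a_inv_closed M.R.one_closed M.smult_closed)
    then show ?thesis using smult[OF _ x, of "\<ominus>\<^bsub>R\<^esub> \<one>\<^bsub>R\<^esub>"] by simp
  qed
  have H_comm: "y \<ominus>\<^bsub>M\<^esub> x \<in> H" if "x \<ominus>\<^bsub>M\<^esub> y \<in> H" "x \<in> carrier M" "y \<in> carrier M" for x y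
    using inv[OF that(1)] that(2,3) by (simp add: M.minus_eq M.minus_add M.a_comm)
  have H_trans: "x \<ominus>\<^bsub>M\<^esub> w \<in> H" if "x \<ominus>\<^bsub>M\<^esub> y \<in> H" "y \<ominus>\<^bsub>M\<^esub> w \<in> H"
    "x \<in> carrier M" "y \<in> carrier M" "w \<in> carrier M" for x y w
  proof -
    have "(x \<ominus>\<^bsub>M\<^esub> y) \<oplus>\<^bsub>M\<^esub> (y \<ominus>\<^bsub>M\<^esub> w) = x \<oplus>\<^bsub>M\<^esub> ((\<ominus>\<^bsub>M\<^esub> y \<oplus>\<^bsub>M\<^esub> y) \<oplus>\<^bsub>M\<^esub> \<ominus>\<^bsub>M\<^esub> w)"
      using that(3-5) by (simp add: M.minus_eq M.a_assoc)
    also have "\<dots> = x \<ominus>\<^bsub>M\<^esub> w" using that(3-5) by (simp add: M.minus_eq M.l_neg)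
    finally show ?thesis using add[OF that(1,2)] by simp
  qed
  define \<phi> where "\<phi> x = (SOME y. y \<in> carrier M \<and> x \<ominus>\<^bsub>M\<^esub> y \<in> H)" for x
  have \<phi>: "\<phi> x \<in> carrier M" "x \<ominus>\<^bsub>M\<^esub> \<phi> x \<in> H" if "x \<in> carrier M" for x
  proof -
    have "\<exists>y. y \<in> carrier M \<and> x \<ominus>\<^bsub>M\<^esub> y \<in> H" 
      using that zero by (auto intro!: exI[of _ x] simp: M.minus_eq M.r_neg)
    from someI_ex[OF this] show "\<phi> x \<in> carrier M" "x \<ominus>\<^bsub>M\<^esub> \<phi> x \<in> H" unfolding \<phi>_def by auto
  qed
  have \<phi>_eq: "\<phi> x = \<phi> y \<longleftrightarrow> x \<ominus>\<^bsub>M\<^esub> y \<in> H" if xy: "x \<in> carrier M" "y \<in> carrier M" for x y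
  proof
    assume "\<phi> x = \<phi> y"
    then show "x \<ominus>\<^bsub>M\<^esub> y \<in> H" using \<phi>[OF xy(1)] \<phi>[OF xy(2)] H_comm H_trans xy by metis
  next
    assume xy': "x \<ominus>\<^bsub>M\<^esub> y \<in> H"
    have "x \<ominus>\<^bsub>M\<^esub> w \<in> H \<longleftrightarrow> y \<ominus>\<^bsub>M\<^esub> w \<in> H" if "w \<in> carrier M" for w
      using H_trans H_comm xy xy' that by blast
    then have "(\<lambda>w. w \<in> carrier M \<and> x \<ominus>\<^bsub>M\<^esub> w \<in> H) = (\<lambda>w. w \<in> carrier M \<and> y \<ominus>\<^bsub>M\<^esub> w \<in> H)" by blast
    then show "\<phi> x = \<phi> y" unfolding \<phi>_def by simp
  qed
  interpret module_congruence R M \<phi>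
  proof
    fix x x' y y' assume c: "x \<in> carrier M" "x' \<in> carrier M" "y \<in> carrier M" "y' \<in> carrier M"
      and "\<phi> x = \<phi> x'" "\<phi> y = \<phi> y'"
    then have "(x \<ominus>\<^bsub>M\<^esub> x') \<oplus>\<^bsub>M\<^esub> (y \<ominus>\<^bsub>M\<^esub> y') \<in> H" using add \<phi>_eq by metis
    moreover have "(x \<ominus>\<^bsub>M\<^esub> x') \<oplus>\<^bsub>M\<^esub> (y \<ominus>\<^bsub>M\<^esub> y') = (x \<oplus>\<^bsub>M\<^esub> y) \<ominus>\<^bsub>M\<^esub> (x' \<oplus>\<^bsub>M\<^esub> y')"
      using c by (simp add: M.minus_eq M.minus_add M.a_ac)
    ultimately show "\<phi> (x \<oplus>\<^bsub>M\<^esub> y) = \<phi> (x' \<oplus>\<^bsub>M\<^esub> y')" using c \<phi>_eq by simp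
  next
    fix a x x' assume c: "a \<in> carrier R" "x \<in> carrier M" "x' \<in> carrier M" and "\<phi> x = \<phi> x'"
    then have "a \<odot>\<^bsub>M\<^esub> (x \<ominus>\<^bsub>M\<^esub> x') \<in> H" using smult \<phi>_eq by metis
    moreover have "a \<odot>\<^bsub>M\<^esub> (x \<ominus>\<^bsub>M\<^esub> x') = a \<odot>\<^bsub>M\<^esub> x \<ominus>\<^bsub>M\<^esub> a \<odot>\<^bsub>M\<^esub> x'"
    proof -
      have "a \<odot>\<^bsub>M\<^esub> (x \<ominus>\<^bsub>M\<^esub> x') \<oplus>\<^bsub>M\<^esub> a \<odot>\<^bsub>M\<^esub> x' = a \<odot>\<^bsub>M\<^esub> x"
        using c M.smult_r_distr[of a "x \<ominus>\<^bsub>M\<^esub> x'" x'] by (simp add: M.minus_eq M.a_assoc M.l_neg)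
      then show ?thesis using c
        by (metis M.M.minus_closed M.add.inv_solve_right M.minus_eq M.smult_closed)
    qed
    ultimately show "\<phi> (a \<odot>\<^bsub>M\<^esub> x) = \<phi> (a \<odot>\<^bsub>M\<^esub> x')" using c \<phi>_eq M.smult_closed by simp
  qed
  show ?thesis
  proof (intro exI conjI)
    show "left_module R (image_module \<phi> M)" by (rule left_module_image_module)
    show "carrier (image_module \<phi> M) \<subseteq> carrier M" using \<phi> by (auto simp: carrier_image_module)
    show "(\<lambda>x \<in> carrier M. \<phi> x) \<in> mod_hom R M (image_module \<phi> M)" by (rule mod_hom_to_image_module)
    show "\<forall>x \<in> carrier M. (\<lambda>x \<in> carrier M. \<phi> x) x = \<zero>\<^bsub>image_module \<phi> M\<^esub> \<longleftrightarrow> x \<in> H"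
      using \<phi>_eq minus_zero by (simp add: zero_image_module)
  qed
qed

section \<open>Copowers in categories of modules\<close>

lemma LMod_simps [simp]:
  "Obj (LMod \<U> T) = {M. left_module T M \<and> carrier M \<in> \<U>}"
  "Hom (LMod \<U> T) M N = mod_hom T M N"
  "Id (LMod \<U> T) M = (\<lambda>x \<in> carrier M. x)"
  "Comp (LMod \<U> T) L M N f g = compose (carrier L) g f"
  by (simp_all add: LMod_def)

text \<open>
  In a module category a copower is generated by the images of the injections: otherwise the
  quotient by the submodule generated by them would admit two maps from \<open>P\<close> that agree on all
  injections.  So every element of \<open>P\<close> is a finite sum of elements \<open>i n a\<close>; the projections
  recover the summands, and an element killed by all projections is zero.
\<close>

lemma LMod_not_lossy_copower:
  fixes \<U> :: "'x set set" and T :: "('t, 'q) ring_scheme"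
  assumes "module_universe \<U>"
  shows "\<not> lossy_copower (LMod \<U> T) A P K z i p f g"
proof
  assume lossy: "lossy_copower (LMod \<U> T) A P K z i p f g"
  then have mods: "left_module T A" "left_module T P" "left_module T K" and PU: "carrier P \<in> \<U>"
    and z: "z \<in> mod_hom T A A" and i: "\<And>n. i n \<in> mod_hom T A P" and p: "\<And>n. p n \<in> mod_hom T P A"
    and ez: "\<And>e. e \<in> mod_hom T A A \<Longrightarrow> compose (carrier A) z e = z"
    and ip: "\<And>m n. compose (carrier A) (p n) (i m) = (if m = n then (\<lambda>x \<in> carrier A. x) else z)"
    and fg: "f \<in> mod_hom T K P" "g \<in> mod_hom T K P" "f \<noteq> g"
    and lose: "\<And>n. compose (carrier K) (p n) f = compose (carrier K) (p n) g"
    unfolding lossy_copower_def by (simp_all cong: if_cong)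
  have epi: "h = h'" if "left_module T X" "carrier X \<in> \<U>" "h \<in> mod_hom T P X" "h' \<in> mod_hom T P X"
    "\<And>n. compose (carrier A) h (i n) = compose (carrier A) h' (i n)"
    for X :: "('t, 'x) module" and h h'
    using lossy_copower_jointly_epic[OF lossy, of X h h'] that by simp
  interpret A: left_module T A by fact
  interpret P: left_module T P by fact
  note hom_zero = mod_hom_zero[OF A.M.abelian_group_axioms P.M.abelian_group_axioms i]
    mod_hom_zero[OF P.M.abelian_group_axioms A.M.abelian_group_axioms p]
  \<comment> \<open>The zero homomorphism is absorbed by \<open>z\<close>, hence \<open>z\<close> is zero.\<close>
  have z0: "z a = \<zero>\<^bsub>A\<^esub>" if a: "a \<in> carrier A" for a
  proof -
    have "compose (carrier A) z (\<lambda>x \<in> carrier A. \<zero>\<^bsub>A\<^esub>) = z"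
      by (rule ez[OF zero_mod_hom[OF mods(1,1)]])
    then have "z a = z \<zero>\<^bsub>A\<^esub>" using a by (metis compose_eq restrict_apply')
    then show ?thesis
      using mod_hom_zero[OF A.M.abelian_group_axioms A.M.abelian_group_axioms z] by simp
  qed
  have pi: "p n (i m a) = (if m = n then a else \<zero>\<^bsub>A\<^esub>)" if "a \<in> carrier A" for m n a
    using fun_cong[OF ip, of n m a] that z0 by (auto simp: compose_eq split: if_splits)
  \<comment> \<open>\<open>e n\<close> is the sum of \<open>i k \<circ> p k\<close> over \<open>k < n\<close>, an idempotent endomorphism.\<close>
  define e where "e = rec_nat (\<lambda>x. \<zero>\<^bsub>P\<^esub>) (\<lambda>n r x. r x \<oplus>\<^bsub>P\<^esub> i n (p n x))"
  have e_0: "e 0 x = \<zero>\<^bsub>P\<^esub>" and e_Suc: "e (Suc n) x = e n x \<oplus>\<^bsub>P\<^esub> i n (p n x)" for n x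
    by (simp_all add: e_def)
  have [simp]: "i n (p n x) \<in> carrier P" if "x \<in> carrier P" for n x
    using mod_hom_closed[OF i mod_hom_closed[OF p that]] .
  have [simp]: "p n x \<in> carrier A" if "x \<in> carrier P" for n x
    using mod_hom_closed[OF p that] .
  have e_closed [simp]: "e n x \<in> carrier P" if "x \<in> carrier P" for n x
    using that by (induction n) (auto simp: e_0 e_Suc)
  have e_add: "e n (x \<oplus>\<^bsub>P\<^esub> y) = e n x \<oplus>\<^bsub>P\<^esub> e n y" if "x \<in> carrier P" "y \<in> carrier P" for n x y
    using that by (induction n) (auto simp: e_0 e_Suc mod_hom_add[OF p] mod_hom_add[OF i] P.M.a_ac)
  have e_smult: "e n (a \<odot>\<^bsub>P\<^esub> x) = a \<odot>\<^bsub>P\<^esub> e n x" if "a \<in> carrier T" "x \<in> carrier P" for n a x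
    using that by (induction n)
      (auto simp: e_0 e_Suc mod_hom_smult[OF p] mod_hom_smult[OF i] P.smult_zero P.smult_r_distr)
  have e_i: "e n (i m a) = (if m < n then i m a else \<zero>\<^bsub>P\<^esub>)" if "a \<in> carrier A" for n m a
    using that mod_hom_closed[OF i that] by (induction n) (auto simp: e_0 e_Suc pi hom_zero less_Suc_eq)
  have e_zero: "e n x = \<zero>\<^bsub>P\<^esub>" if "\<And>k. p k x = \<zero>\<^bsub>A\<^esub>" for n x
    using that by (induction n) (auto simp: e_0 e_Suc hom_zero)
  \<comment> \<open>The submodule generated by the images of the injections: the elements that
      are eventually fixed by \<open>e\<close>. Quantifying over all \<open>n \<ge> N\<close> makes closure under
      addition immediate.\<close>
  define H where "H = {x \<in> carrier P. \<exists>N. \<forall>n \<ge> N. e n x = x}"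
  have H_smult: "a \<odot>\<^bsub>P\<^esub> x \<in> H" if "a \<in> carrier T" "x \<in> H" for a x
    using that unfolding H_def by (auto simp: P.smult_closed) (metis e_smult)
  have H_add: "x \<oplus>\<^bsub>P\<^esub> y \<in> H" if xyH: "x \<in> H" "y \<in> H" for x y
  proof -
    obtain M where M: "\<forall>n \<ge> M. e n x = x" using xyH(1) unfolding H_def by auto
    obtain N where N: "\<forall>n \<ge> N. e n y = y" using xyH(2) unfolding H_def by auto
    have xy: "x \<in> carrier P" "y \<in> carrier P" using xyH unfolding H_def by auto
    then have "\<forall>n \<ge> max M N. e n (x \<oplus>\<^bsub>P\<^esub> y) = x \<oplus>\<^bsub>P\<^esub> y" using M N by (simp add: e_add)
    then show ?thesis using P.M.a_closed[OF xy] unfolding H_def by blast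
  qed
  have H_zero: "\<zero>\<^bsub>P\<^esub> \<in> H" unfolding H_def using e_zero hom_zero by auto
  obtain Q :: "('t, 'x) module" and q where Q: "left_module T Q" "carrier Q \<subseteq> carrier P"
    and q: "q \<in> mod_hom T P Q" "\<And>x. x \<in> carrier P \<Longrightarrow> q x = \<zero>\<^bsub>Q\<^esub> \<longleftrightarrow> x \<in> H"
    using quotient_module[OF mods(2) _ H_zero H_add H_smult] unfolding H_def by blast
  have "q = (\<lambda>x \<in> carrier P. \<zero>\<^bsub>Q\<^esub>)"
  proof (rule epi[OF Q(1)])
    show "carrier Q \<in> \<U>" using assms PU Q(2) unfolding module_universe_def
      by (meson subset_imp_lepoll)
    have "i n a \<in> H" if "a \<in> carrier A" for n a
      using that mod_hom_closed[OF i that] unfolding H_def by (auto simp: e_i intro!: exI[of _ "Suc n"])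
    then show "compose (carrier A) q (i n) = compose (carrier A) (\<lambda>x \<in> carrier P. \<zero>\<^bsub>Q\<^esub>) (i n)" for n
      using q(2) mod_hom_closed[OF i] by (auto simp: compose_def intro!: restrict_ext)
  qed (use q zero_mod_hom mods Q in auto)
  then have PH: "x \<in> H" if "x \<in> carrier P" for x using q(2) that by (metis restrict_apply')
  have "f x = g x" if x: "x \<in> carrier K" for x
  proof -
    have c: "f x \<in> carrier P" "g x \<in> carrier P" using x fg mod_hom_closed by metis+
    have "p n (f x) = p n (g x)" for n using fun_cong[OF lose, of n x] x by (simp add: compose_eq)
    then have "p n (f x \<ominus>\<^bsub>P\<^esub> g x) = \<zero>\<^bsub>A\<^esub>" for n
      using mod_hom_minus[OF P.M.abelian_group_axioms A.M.abelian_group_axioms p c] c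
      by (simp add: A.M.minus_eq A.M.r_neg)
    then have "e n (f x \<ominus>\<^bsub>P\<^esub> g x) = \<zero>\<^bsub>P\<^esub>" for n using e_zero by blast
    moreover have "\<exists>n. e n (f x \<ominus>\<^bsub>P\<^esub> g x) = f x \<ominus>\<^bsub>P\<^esub> g x" using PH c unfolding H_def by blast
    ultimately have "f x \<ominus>\<^bsub>P\<^esub> g x = \<zero>\<^bsub>P\<^esub>" by auto
    then have "\<ominus>\<^bsub>P\<^esub> (\<ominus>\<^bsub>P\<^esub> g x) = f x"
      using c by (intro P.M.minus_equality) (auto simp: P.M.minus_eq)
    then show ?thesis using c by simp
  qed
  then show False using fg mod_hom_eqI by metis
qed

section \<open>Countable powers of the regular module\<close>

definition regular_module :: "('r, 'p) ring_scheme \<Rightarrow> ('r, 'r) module"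
  where "regular_module R = \<lparr>carrier = carrier R, mult = undefined, one = undefined,
     zero = \<zero>\<^bsub>R\<^esub>, add = add R, smult = mult R\<rparr>"

definition sequence_module :: "('r, 'p) ring_scheme \<Rightarrow> ('r, nat \<Rightarrow> 'r) module"
  where "sequence_module R = \<lparr>carrier = UNIV \<rightarrow> carrier R, mult = undefined, one = undefined,
     zero = (\<lambda>n. \<zero>\<^bsub>R\<^esub>), add = (\<lambda>x y n. x n \<oplus>\<^bsub>R\<^esub> y n), smult = (\<lambda>a x n. a \<otimes>\<^bsub>R\<^esub> x n)\<rparr>"

lemma left_module_regular_module:
  fixes R (structure) assumes "ring R" shows "left_module R (regular_module R)"
proof -
  interpret ring R by fact
  have "abelian_group (regular_module R)"
  proof (rule abelian_groupI)
    fix x assume "x \<in> carrier (regular_module R)"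
    then show "\<exists>y \<in> carrier (regular_module R). y \<oplus>\<^bsub>regular_module R\<^esub> x = \<zero>\<^bsub>regular_module R\<^esub>"
      by (intro bexI[of _ "\<ominus> x"]) (auto simp: regular_module_def l_neg)
  qed (auto simp: regular_module_def a_ac)
  moreover have "left_module_axioms R (regular_module R)"
    by unfold_locales (auto simp: regular_module_def l_distr r_distr m_assoc)
  ultimately show ?thesis using ring_axioms by (simp add: left_module_def)
qed

lemma left_module_sequence_module:
  fixes R (structure) assumes "ring R" shows "left_module R (sequence_module R)"
proof -
  interpret ring R by fact
  have "abelian_group (sequence_module R)"
  proof (rule abelian_groupI)
    fix x assume "x \<in> carrier (sequence_module R)"
    then show "\<exists>y \<in> carrier (sequence_module R). y \<oplus>\<^bsub>sequence_module R\<^esub> x = \<zero>\<^bsub>sequence_module R\<^esub>"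
      by (intro bexI[of _ "\<lambda>n. \<ominus> x n"]) (auto simp: sequence_module_def Pi_def l_neg)
  qed (auto simp: sequence_module_def Pi_def a_ac)
  moreover have "left_module_axioms R (sequence_module R)"
    by unfold_locales (auto simp: sequence_module_def Pi_def l_distr r_distr m_assoc)
  ultimately show ?thesis using ring_axioms by (simp add: left_module_def)
qed

text \<open>
  Rings live on types of their own, whereas the objects of the categories have elements of type
  \<^typ>\<open>'x\<close>; injections provided by smallness carry the modules over.
\<close>

lemma module_transport:
  assumes "left_module R M" and inj: "inj_on \<phi> (carrier M)"
  shows "\<exists>(N :: ('r, 'y) module) \<psi>. left_module R N \<and> carrier N = \<phi> ` carrier M \<and>
    (\<lambda>x \<in> carrier M. \<phi> x :: 'y) \<in> mod_hom R M N \<and> \<psi> \<in> mod_hom R N M \<and>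
    (\<forall>x \<in> carrier M. \<psi> (\<phi> x) = x)"
proof -
  interpret left_module R M by fact
  interpret module_congruence R M \<phi>
    by unfold_locales (metis inj inj_onD)+
  have "(\<lambda>x \<in> carrier M. x) \<in> mod_hom R M M"
    by (rule mod_hom_Id[OF M.abelian_group_axioms smult_closed])
  then obtain \<psi> where "\<psi> \<in> mod_hom R (image_module \<phi> M) M"
    "\<forall>x \<in> carrier M. \<psi> (\<phi> x) = (\<lambda>x \<in> carrier M. x) x"
    using mod_hom_from_image_module inj by (metis inj_onD)
  then show ?thesis
    using left_module_image_module carrier_image_module mod_hom_to_image_module by auto
qed

text \<open>
  \<open>P\<close> behaves like a countable power of \<open>A\<close> with projections \<open>\<pi>\<close> and coordinate embeddings \<open>\<epsilon>\<close>, and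
  \<open>q\<close> is a nonzero homomorphism that kills all coordinate embeddings.  Reversing all arrows turns
  these data into a lossy copower, \<open>\<pi>\<close> giving the injections and \<open>\<epsilon>\<close> the projections.
\<close>

definition power_with_quotient ::
    "('r, 'p) ring_scheme \<Rightarrow> ('r, 'x) module \<Rightarrow> ('r, 'x) module \<Rightarrow> ('r, 'x) module \<Rightarrow>
     (nat \<Rightarrow> 'x \<Rightarrow> 'x) \<Rightarrow> (nat \<Rightarrow> 'x \<Rightarrow> 'x) \<Rightarrow> ('x \<Rightarrow> 'x) \<Rightarrow> bool"
  where "power_with_quotient R A P K \<pi> \<epsilon> q \<longleftrightarrow>
     left_module R A \<and> left_module R P \<and> left_module R K \<and>
     (\<forall>n. \<pi> n \<in> mod_hom R P A) \<and> (\<forall>n. \<epsilon> n \<in> mod_hom R A P) \<and> q \<in> mod_hom R P K \<and>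
     (\<forall>m n. \<forall>a \<in> carrier A. \<pi> m (\<epsilon> n a) = (if m = n then a else \<zero>\<^bsub>A\<^esub>)) \<and>
     (\<forall>x \<in> carrier P. \<forall>y \<in> carrier P. (\<forall>n. \<pi> n x = \<pi> n y) \<longrightarrow> x = y) \<and>
     (\<forall>n. \<forall>a \<in> carrier A. q (\<epsilon> n a) = \<zero>\<^bsub>K\<^esub>) \<and> (\<exists>x \<in> carrier P. q x \<noteq> \<zero>\<^bsub>K\<^esub>)"

text \<open>
  Here \<open>A\<close> is the regular module, \<open>P\<close> the module of all sequences in \<open>R\<close>, and \<open>K\<close> its quotient by the
  sequences of finite support.  The constant sequence \<open>1\<close> survives in \<open>K\<close> because \<open>1 \<noteq> 0\<close>.  The
  closure of the universe under countable powers makes room for \<open>P\<close>.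
\<close>

lemma power_with_quotient_exists:
  fixes R :: "('r, 'p) ring_scheme" (structure) and \<U> :: "'x set set"
  assumes "ring R" and nontriv: "\<one> \<noteq> \<zero>"
    and \<U>: "module_universe \<U>" and small: "small_in (carrier R) \<U>"
  shows "\<exists>(A :: ('r, 'x) module) P K \<pi> \<epsilon> q. power_with_quotient R A P K \<pi> \<epsilon> q \<and>
    carrier A \<in> \<U> \<and> carrier P \<in> \<U> \<and> carrier K \<in> \<U>"
proof -
  interpret ring R by fact
  define A\<^sub>0 P\<^sub>0 where "A\<^sub>0 = regular_module R" and "P\<^sub>0 = sequence_module R"
  have A\<^sub>0: "left_module R A\<^sub>0" and P\<^sub>0: "left_module R P\<^sub>0"
    unfolding A\<^sub>0_def P\<^sub>0_def using left_module_regular_module left_module_sequence_module assms by auto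
  have cA\<^sub>0: "carrier A\<^sub>0 = carrier R" "\<zero>\<^bsub>A\<^sub>0\<^esub> = \<zero>" and cP\<^sub>0: "carrier P\<^sub>0 = (UNIV \<rightarrow> carrier R)"
    by (simp_all add: A\<^sub>0_def P\<^sub>0_def regular_module_def sequence_module_def)
  have down: "B \<in> \<U>" if "B \<lesssim> A" "A \<in> \<U>" for A B using \<U> that unfolding module_universe_def by blast
  obtain U\<^sub>A where U\<^sub>A: "U\<^sub>A \<in> \<U>" "carrier R \<lesssim> U\<^sub>A" using small unfolding small_in_def by blast
  obtain U\<^sub>P where U\<^sub>P: "U\<^sub>P \<in> \<U>" "(UNIV :: nat set) \<rightarrow>\<^sub>E U\<^sub>A \<lesssim> U\<^sub>P"
    using \<U> U\<^sub>A unfolding module_universe_def by blast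
  obtain \<alpha> where \<alpha>: "inj_on \<alpha> (carrier A\<^sub>0)" "\<alpha> ` carrier A\<^sub>0 \<subseteq> U\<^sub>A"
    using U\<^sub>A(2) unfolding lepoll_def cA\<^sub>0 by blast
  have P\<^sub>0_le: "carrier P\<^sub>0 \<lesssim> (UNIV :: nat set) \<rightarrow>\<^sub>E U\<^sub>A"
    unfolding lepoll_def
  proof (intro exI conjI)
    show "inj_on (\<lambda>x n. \<alpha> (x n)) (carrier P\<^sub>0)"
    proof (rule inj_onI)
      fix x y assume xy: "x \<in> carrier P\<^sub>0" "y \<in> carrier P\<^sub>0" "(\<lambda>n. \<alpha> (x n)) = (\<lambda>n. \<alpha> (y n))"
      show "x = y"
      proof
        fix n
        have "\<alpha> (x n) = \<alpha> (y n)" using fun_cong[OF xy(3)] .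
        then show "x n = y n" using xy(1,2) \<alpha>(1) unfolding cP\<^sub>0 cA\<^sub>0 by (auto dest: inj_onD)
      qed
    qed
    show "(\<lambda>x n. \<alpha> (x n)) ` carrier P\<^sub>0 \<subseteq> UNIV \<rightarrow>\<^sub>E U\<^sub>A" using \<alpha>(2) unfolding cP\<^sub>0 cA\<^sub>0 by auto
  qed
  obtain \<beta> where \<beta>: "inj_on \<beta> (carrier P\<^sub>0)" "\<beta> ` carrier P\<^sub>0 \<subseteq> U\<^sub>P"
    using lepoll_trans[OF P\<^sub>0_le U\<^sub>P(2)] unfolding lepoll_def by blast
  obtain A :: "('r, 'x) module" and \<alpha>' where A: "left_module R A" "carrier A = \<alpha> ` carrier A\<^sub>0"
    and \<alpha>h: "(\<lambda>x \<in> carrier A\<^sub>0. \<alpha> x) \<in> mod_hom R A\<^sub>0 A" "\<alpha>' \<in> mod_hom R A A\<^sub>0"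
    and \<alpha>': "\<And>x. x \<in> carrier A\<^sub>0 \<Longrightarrow> \<alpha>' (\<alpha> x) = x"
    using module_transport[OF A\<^sub>0 \<alpha>(1)] by blast
  obtain P :: "('r, 'x) module" and \<beta>' where P: "left_module R P" "carrier P = \<beta> ` carrier P\<^sub>0"
    and \<beta>h: "(\<lambda>x \<in> carrier P\<^sub>0. \<beta> x) \<in> mod_hom R P\<^sub>0 P" "\<beta>' \<in> mod_hom R P P\<^sub>0"
    and \<beta>': "\<And>x. x \<in> carrier P\<^sub>0 \<Longrightarrow> \<beta>' (\<beta> x) = x"
    using module_transport[OF P\<^sub>0 \<beta>(1)] by blast
  interpret A\<^sub>0: left_module R A\<^sub>0 by fact
  interpret A: left_module R A by fact
  interpret P: left_module R P by fact
  define \<pi> where "\<pi> n = compose (carrier P) (\<lambda>x \<in> carrier A\<^sub>0. \<alpha> x)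
    (compose (carrier P) (\<lambda>x \<in> carrier P\<^sub>0. x n) \<beta>')" for n :: nat
  \<comment> \<open>\<open>\<delta> n a\<close> is the sequence with the single entry \<open>a\<close> at position \<open>n\<close>.\<close>
  define \<delta> where "\<delta> n a = (\<lambda>k. if k = n then a else \<zero>)" for n :: nat and a
  define \<epsilon> where "\<epsilon> n = compose (carrier A) (\<lambda>x \<in> carrier P\<^sub>0. \<beta> x)
    (compose (carrier A) (\<lambda>a \<in> carrier A\<^sub>0. \<delta> n a) \<alpha>')" for n :: nat
  have \<delta>_closed: "\<delta> n a \<in> carrier P\<^sub>0" if "a \<in> carrier R" for n a
    using that by (simp add: \<delta>_def cP\<^sub>0)
  have coord: "(\<lambda>x \<in> carrier P\<^sub>0. x n) \<in> mod_hom R P\<^sub>0 A\<^sub>0" for n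
    by (auto simp: mod_hom_def A\<^sub>0_def P\<^sub>0_def regular_module_def sequence_module_def Pi_def)
  have inj: "(\<lambda>a \<in> carrier A\<^sub>0. \<delta> n a) \<in> mod_hom R A\<^sub>0 P\<^sub>0" for n
    by (auto simp: mod_hom_def A\<^sub>0_def P\<^sub>0_def regular_module_def sequence_module_def Pi_def \<delta>_def)
  have \<pi>: "\<pi> n \<in> mod_hom R P A" for n unfolding \<pi>_def
    by (rule mod_hom_comp[OF left_module_basics[OF P(1)]
          mod_hom_comp[OF left_module_basics[OF P(1)] \<beta>h(2) coord] \<alpha>h(1)])
  have \<epsilon>: "\<epsilon> n \<in> mod_hom R A P" for n unfolding \<epsilon>_def
    by (rule mod_hom_comp[OF left_module_basics[OF A(1)]
          mod_hom_comp[OF left_module_basics[OF A(1)] \<alpha>h(2) inj] \<beta>h(1)])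
  have \<pi>_\<beta>: "\<pi> n (\<beta> x) = \<alpha> (x n)" if "x \<in> carrier P\<^sub>0" for n x
    using that by (auto simp: \<pi>_def compose_def P(2) \<beta>' cA\<^sub>0 cP\<^sub>0)
  have \<epsilon>_\<alpha>: "\<epsilon> n (\<alpha> a) = \<beta> (\<delta> n a)" if "a \<in> carrier R" for n a
    using that \<delta>_closed[OF that] by (auto simp: \<epsilon>_def compose_def A(2) \<alpha>' cA\<^sub>0)
  have \<alpha>0: "\<alpha> \<zero> = \<zero>\<^bsub>A\<^esub>"
    using mod_hom_zero[OF A\<^sub>0.M.abelian_group_axioms A.M.abelian_group_axioms \<alpha>h(1)] by (simp add: cA\<^sub>0)
  have \<pi>\<epsilon>: "\<pi> m (\<epsilon> n a) = (if m = n then a else \<zero>\<^bsub>A\<^esub>)" if a: "a \<in> carrier A" for m n a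
  proof -
    obtain b where b: "b \<in> carrier R" "a = \<alpha> b" using a unfolding A(2) cA\<^sub>0 by blast
    then show ?thesis using \<epsilon>_\<alpha> \<pi>_\<beta> \<delta>_closed \<alpha>0 by (simp add: \<delta>_def)
  qed
  have sep: "x = y" if xy: "x \<in> carrier P" "y \<in> carrier P" "\<And>n. \<pi> n x = \<pi> n y" for x y
  proof -
    obtain u v where uv: "u \<in> carrier P\<^sub>0" "v \<in> carrier P\<^sub>0" "x = \<beta> u" "y = \<beta> v"
      using xy unfolding P(2) by blast
    have "u n = v n" for n
    proof (rule inj_onD[OF \<alpha>(1)])
      show "\<alpha> (u n) = \<alpha> (v n)" using xy(3)[of n] uv \<pi>_\<beta> by simp
    qed (use uv in \<open>auto simp: cP\<^sub>0 cA\<^sub>0\<close>)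
    then have "u = v" by (rule ext)
    then show ?thesis using uv by simp
  qed
  \<comment> \<open>The sequences of finite support.\<close>
  define H where "H = {x \<in> carrier P. finite {n. \<pi> n x \<noteq> \<zero>\<^bsub>A\<^esub>}}"
  have \<pi>0: "\<pi> n \<zero>\<^bsub>P\<^esub> = \<zero>\<^bsub>A\<^esub>" for n
    by (rule mod_hom_zero[OF P.M.abelian_group_axioms A.M.abelian_group_axioms \<pi>])
  have H_zero: "\<zero>\<^bsub>P\<^esub> \<in> H" by (simp add: H_def \<pi>0)
  have H_add: "x \<oplus>\<^bsub>P\<^esub> y \<in> H" if "x \<in> H" "y \<in> H" for x y
  proof -
    have "{n. \<pi> n (x \<oplus>\<^bsub>P\<^esub> y) \<noteq> \<zero>\<^bsub>A\<^esub>} \<subseteq> {n. \<pi> n x \<noteq> \<zero>\<^bsub>A\<^esub>} \<union> {n. \<pi> n y \<noteq> \<zero>\<^bsub>A\<^esub>}"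
      using that mod_hom_add[OF \<pi>] by (auto simp: H_def)
    then show ?thesis using that finite_subset unfolding H_def by auto
  qed
  have H_smult: "a \<odot>\<^bsub>P\<^esub> x \<in> H" if "a \<in> carrier R" "x \<in> H" for a x
  proof -
    have "{n. \<pi> n (a \<odot>\<^bsub>P\<^esub> x) \<noteq> \<zero>\<^bsub>A\<^esub>} \<subseteq> {n. \<pi> n x \<noteq> \<zero>\<^bsub>A\<^esub>}"
      using that mod_hom_smult[OF \<pi>] by (auto simp: H_def A.smult_zero)
    then show ?thesis using that finite_subset P.smult_closed unfolding H_def by auto
  qed
  obtain K :: "('r, 'x) module" and q where K: "left_module R K" "carrier K \<subseteq> carrier P"
    and q: "q \<in> mod_hom R P K" "\<And>x. x \<in> carrier P \<Longrightarrow> q x = \<zero>\<^bsub>K\<^esub> \<longleftrightarrow> x \<in> H"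
    using quotient_module[OF P(1) _ H_zero H_add H_smult] unfolding H_def by blast
  have PU: "carrier P \<in> \<U>" using down[OF subset_imp_lepoll U\<^sub>P(1)] \<beta>(2) P(2) by simp
  have q\<epsilon>: "q (\<epsilon> n a) = \<zero>\<^bsub>K\<^esub>" if a: "a \<in> carrier A" for n a
  proof -
    have "{m. \<pi> m (\<epsilon> n a) \<noteq> \<zero>\<^bsub>A\<^esub>} \<subseteq> {n}" using \<pi>\<epsilon>[OF a] by auto
    then have "\<epsilon> n a \<in> H" using mod_hom_closed[OF \<epsilon> a] finite_subset unfolding H_def by auto
    then show ?thesis using q(2) mod_hom_closed[OF \<epsilon> a] by blast
  qed
  have one: "(\<lambda>n. \<one>) \<in> carrier P\<^sub>0" by (simp add: cP\<^sub>0)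
  have "\<pi> n (\<beta> (\<lambda>n. \<one>)) \<noteq> \<zero>\<^bsub>A\<^esub>" for n
    using \<pi>_\<beta>[OF one] \<alpha>0 nontriv inj_onD[OF \<alpha>(1)] by (metis cA\<^sub>0(1) one_closed zero_closed)
  then have "\<beta> (\<lambda>n. \<one>) \<notin> H" unfolding H_def by simp
  moreover have "\<beta> (\<lambda>n. \<one>) \<in> carrier P" using one P(2) by blast
  ultimately have "\<exists>x \<in> carrier P. q x \<noteq> \<zero>\<^bsub>K\<^esub>" using q(2) by blast
  moreover have "carrier A \<in> \<U>" using down[OF subset_imp_lepoll U\<^sub>A(1)] \<alpha>(2) A(2) by simp
  moreover have "carrier K \<in> \<U>" using down[OF subset_imp_lepoll PU] K(2) by simp
  ultimately have "power_with_quotient R A P K \<pi> \<epsilon> q" "carrier A \<in> \<U>" "carrier K \<in> \<U>"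
    unfolding power_with_quotient_def using A(1) P(1) K(1) \<pi> \<epsilon> \<pi>\<epsilon> sep q(1) q\<epsilon> by blast+
  with PU show ?thesis by blast
qed

section \<open>The adjoint category\<close>

text \<open>
  The element \<^term>\<open>undefined\<close> is merely some element of the type, so that one constant serves all
  universes.
\<close>

definition zero_module :: "('r, 'x) module"
  where "zero_module = \<lparr>carrier = {undefined}, mult = undefined, one = undefined,
     zero = undefined, add = (\<lambda>x y. undefined), smult = (\<lambda>a x. undefined)\<rparr>"

lemma abelian_group_zero_module: "abelian_group zero_module"
  by (rule abelian_groupI) (auto simp: zero_module_def)

lemma left_module_zero_module:
  assumes "ring R" shows "left_module R zero_module"
proof -
  have "left_module_axioms R zero_module"
    by unfold_locales (auto simp: zero_module_def)
  then show ?thesis using assms abelian_group_zero_module by (simp add: left_module_def)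
qed

lemma carrier_zero_module_in_universe:
  fixes \<U> :: "'x set set"
  assumes "module_universe \<U>" "small_in (carrier R) \<U>" "a \<in> carrier R"
  shows "carrier (zero_module :: ('r, 'x) module) \<in> \<U>"
proof -
  obtain A where "A \<in> \<U>" "carrier R \<lesssim> A" using assms(2) unfolding small_in_def by blast
  moreover from this obtain b where "b \<in> A" using assms(3) unfolding lepoll_def by blast
  then have "{undefined :: 'x} \<lesssim> A" unfolding lepoll_def by (intro exI[of _ "\<lambda>x. b"]) auto
  ultimately show ?thesis using assms(1) unfolding module_universe_def zero_module_def by auto
qed

lemma mod_hom_from_zero_module_unique:
  assumes "abelian_group M" "f \<in> mod_hom R zero_module M" "g \<in> mod_hom R zero_module M"
  shows "f = g"
proof -
  have "f undefined = g undefined"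
    using mod_hom_zero[OF abelian_group_zero_module assms(1,2)]
      mod_hom_zero[OF abelian_group_zero_module assms(1,3)] by (simp add: zero_module_def)
  then show ?thesis
    by (intro mod_hom_eqI[OF assms(2,3)]) (simp add: zero_module_def)
qed

lemma mod_hom_to_zero_module_unique:
  assumes "f \<in> mod_hom R M zero_module" "g \<in> mod_hom R M zero_module"
  shows "f = g"
proof (rule mod_hom_eqI[OF assms])
  fix x assume "x \<in> carrier M"
  then show "f x = g x"
    using mod_hom_closed[OF assms(1)] mod_hom_closed[OF assms(2)] by (simp add: zero_module_def)
qed

lemma Adj_simps:
  "(U, V, B) \<in> Obj (Adj \<U> R S W) \<longleftrightarrow> left_module R U \<and> right_module S V \<and>
     carrier U \<in> \<U> \<and> carrier V \<in> \<U> \<and> bimap R S W U V B"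
  "(\<mu>, \<nu>) \<in> Hom (Adj \<U> R S W) (U, V, B) (U', V', C) \<longleftrightarrow> \<mu> \<in> mod_hom R U U' \<and> \<nu> \<in> mod_hom S V' V \<and>
     (\<forall>u \<in> carrier U. \<forall>v' \<in> carrier V'. C (\<mu> u) v' = B u (\<nu> v'))"
  "Id (Adj \<U> R S W) (U, V, B) = (\<lambda>u \<in> carrier U. u, \<lambda>v \<in> carrier V. v)"
  "Comp (Adj \<U> R S W) (U, V, B) (U', V', C) (U'', V'', D) (\<mu>, \<nu>) (\<mu>', \<nu>') =
     (compose (carrier U) \<mu>' \<mu>, compose (carrier V'') \<nu> \<nu>')"
  by (simp_all add: Adj_def)

lemma bimap_zero:
  assumes "is_bimodule R S W"
  shows "bimap R S W U V (\<lambda>u v. \<zero>\<^bsub>W\<^esub>)"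
proof -
  interpret L: left_module R W using assms by (simp add: is_bimodule_def)
  have "right_module S (right_part W)" using assms by (simp add: is_bimodule_def)
  then have "left_module (op_ring S) (right_part W)"
    using right_module_iff_left_module_op_ring right_module.axioms(1) by blast
  then have "\<zero>\<^bsub>W\<^esub> \<odot>\<^sub>r\<^bsub>W\<^esub> s = \<zero>\<^bsub>W\<^esub>" if "s \<in> carrier S" for s
    using left_module.smult_zero[of "op_ring S" "right_part W" s] that by (simp add: right_part_def)
  then show ?thesis unfolding bimap_def by (simp add: L.smult_zero)
qed

text \<open>
  The right \<open>S\<close>-modules embed contravariantly into the adjoint category by \<open>V \<mapsto> (0, V, 0)\<close>, because
  the second component of a morphism points backwards.  The embedding turns the power of the
  regular right module into a lossy copower.  Joint epicity has to be tested against arbitrary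
  bimaps \<open>(U, V, B)\<close>, but the first component of a morphism out of \<open>(0, P, 0)\<close> is a homomorphism
  \<open>0 \<rightarrow> U\<close> and carries no information.
\<close>

lemma Adj_lossy_copower:
  fixes R :: "('r, 'p) ring_scheme" and S :: "('s, 'q) ring_scheme"
    and W :: "('r, 's, 'w, 'c) bimodule_scheme" and \<U> :: "'x set set"
  assumes R: "ring R" and S: "ring S" "\<one>\<^bsub>S\<^esub> \<noteq> \<zero>\<^bsub>S\<^esub>" and W: "is_bimodule R S W"
    and \<U>: "module_universe \<U>" "small_in (carrier S) \<U>"
  shows "\<exists>A P K z i p f g. lossy_copower (Adj \<U> R S W) A P K z i p f g"
proof -
  obtain A P K :: "('s, 'x) module" and \<pi> \<epsilon> q where pwq: "power_with_quotient (op_ring S) A P K \<pi> \<epsilon> q"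
    and small: "carrier A \<in> \<U>" "carrier P \<in> \<U>" "carrier K \<in> \<U>"
    using power_with_quotient_exists[of "op_ring S" \<U>] ring_op_ring[OF S(1)] S(2) \<U> by auto
  then have left: "left_module (op_ring S) A" "left_module (op_ring S) P" "left_module (op_ring S) K"
    and \<pi>: "\<And>n. \<pi> n \<in> mod_hom S P A" and \<epsilon>: "\<And>n. \<epsilon> n \<in> mod_hom S A P"
    and \<pi>\<epsilon>: "\<And>m n a. a \<in> carrier A \<Longrightarrow> \<pi> m (\<epsilon> n a) = (if m = n then a else \<zero>\<^bsub>A\<^esub>)"
    and sep: "\<And>x y. \<lbrakk>x \<in> carrier P; y \<in> carrier P; \<And>n. \<pi> n x = \<pi> n y\<rbrakk> \<Longrightarrow> x = y"
    and q: "q \<in> mod_hom S P K" "\<And>n a. a \<in> carrier A \<Longrightarrow> q (\<epsilon> n a) = \<zero>\<^bsub>K\<^esub>"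
      "\<exists>x \<in> carrier P. q x \<noteq> \<zero>\<^bsub>K\<^esub>"
    unfolding power_with_quotient_def by simp_all
  have right: "right_module S A" "right_module S P" "right_module S K"
    using left right_module_iff_left_module_op_ring[OF S(1)] by blast+
  let ?Z = "zero_module :: ('r, 'x) module" and ?C = "Adj \<U> R S W"
  have Z: "left_module R ?Z" "carrier ?Z \<in> \<U>"
    using left_module_zero_module[OF R] carrier_zero_module_in_universe[OF \<U>]
      ring.ring_simprules(6)[OF S(1)] by auto
  define J :: "('s, 'x) module \<Rightarrow> ('r, 'x) module \<times> ('s, 'x) module \<times> ('x \<Rightarrow> 'x \<Rightarrow> 'w)"
    where "J V = (zero_module, V, \<lambda>u v. \<zero>\<^bsub>W\<^esub>)" for V
  let ?I = "\<lambda>x \<in> carrier ?Z. x"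
  have idZ: "?I \<in> mod_hom R ?Z ?Z" by (rule mod_hom_Id[OF left_module_basics[OF Z(1)]])
  have J: "J V \<in> Obj ?C" if "right_module S V" "carrier V \<in> \<U>" for V
    using that Z bimap_zero[OF W] by (simp add: J_def Adj_simps)
  have HomJ: "(\<mu>, \<nu>) \<in> Hom ?C (J V) (J V') \<longleftrightarrow> \<mu> = ?I \<and> \<nu> \<in> mod_hom S V' V" for \<mu> \<nu> V V'
    unfolding J_def Adj_simps using idZ mod_hom_to_zero_module_unique[OF _ idZ] by blast
  have CompJ: "Comp ?C (J V) (J V') (J V'') (?I, \<nu>) (?I, \<nu>') = (?I, compose (carrier V'') \<nu> \<nu>')"
    for \<nu> \<nu>' V V' V'' by (simp add: J_def Adj_simps compose_def cong: restrict_cong)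
  have zero: "(\<lambda>a \<in> carrier A. \<zero>\<^bsub>A\<^esub>) \<in> mod_hom S A A" "(\<lambda>x \<in> carrier P. \<zero>\<^bsub>K\<^esub>) \<in> mod_hom S P K"
    using zero_mod_hom[OF left(1,1)] zero_mod_hom[OF left(2,3)] by simp_all
  have "lossy_copower ?C (J A) (J P) (J K) (?I, \<lambda>a \<in> carrier A. \<zero>\<^bsub>A\<^esub>) (\<lambda>n. (?I, \<pi> n))
    (\<lambda>n. (?I, \<epsilon> n)) (?I, q) (?I, \<lambda>x \<in> carrier P. \<zero>\<^bsub>K\<^esub>)"
    unfolding lossy_copower_def
  proof (intro conjI allI ballI impI)
    fix e assume "e \<in> Hom ?C (J A) (J A)"
    then obtain \<nu> where e: "e = (?I, \<nu>)" "\<nu> \<in> mod_hom S A A" using HomJ by (metis surj_pair)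
    have "\<nu> \<zero>\<^bsub>A\<^esub> = \<zero>\<^bsub>A\<^esub>"
      using e(2) mod_hom_zero right_module_basics(1)[OF right(1)] by blast
    then show "Comp ?C (J A) (J A) (J A) e (?I, \<lambda>a \<in> carrier A. \<zero>\<^bsub>A\<^esub>) = (?I, \<lambda>a \<in> carrier A. \<zero>\<^bsub>A\<^esub>)"
      unfolding e CompJ by (auto simp: compose_def)
  next
    fix m n
    show "Comp ?C (J A) (J P) (J A) (?I, \<pi> m) (?I, \<epsilon> n) =
        (if m = n then Id ?C (J A) else (?I, \<lambda>a \<in> carrier A. \<zero>\<^bsub>A\<^esub>))"
      unfolding CompJ by (auto simp: J_def Adj_simps compose_def \<pi>\<epsilon>)
  next
    fix X h h' assume X: "X \<in> Obj ?C" and h: "h \<in> Hom ?C (J P) X" "h' \<in> Hom ?C (J P) X"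
      and eq: "\<forall>n. Comp ?C (J A) (J P) X (?I, \<pi> n) h = Comp ?C (J A) (J P) X (?I, \<pi> n) h'"
    obtain U V B \<mu> \<nu> \<mu>' \<nu>' where [simp]: "X = (U, V, B)" "h = (\<mu>, \<nu>)" "h' = (\<mu>', \<nu>')"
      by (metis surj_pair)
    have U: "left_module R U" and \<mu>: "\<mu> \<in> mod_hom R ?Z U" "\<mu>' \<in> mod_hom R ?Z U"
      and \<nu>: "\<nu> \<in> mod_hom S V P" "\<nu>' \<in> mod_hom S V P"
      using X h by (auto simp: J_def Adj_simps)
    have "\<mu> = \<mu>'" by (rule mod_hom_from_zero_module_unique[OF left_module_basics(1)[OF U] \<mu>])
    moreover have "\<nu> = \<nu>'"
    proof (rule mod_hom_eqI[OF \<nu>])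
      fix v assume v: "v \<in> carrier V"
      have "compose (carrier V) (\<pi> n) \<nu> = compose (carrier V) (\<pi> n) \<nu>'" for n
        using eq by (simp add: J_def Adj_simps)
      then have "\<pi> n (\<nu> v) = \<pi> n (\<nu>' v)" for n using v by (metis compose_eq)
      then show "\<nu> v = \<nu>' v" using sep mod_hom_closed[OF \<nu>(1) v] mod_hom_closed[OF \<nu>(2) v] by blast
    qed
    ultimately show "h = h'" by simp
  next
    show "(?I, q) \<noteq> (?I, \<lambda>x \<in> carrier P. \<zero>\<^bsub>K\<^esub>)" using q(3) by auto
  next
    fix n
    show "Comp ?C (J K) (J P) (J A) (?I, q) (?I, \<epsilon> n) =
        Comp ?C (J K) (J P) (J A) (?I, \<lambda>x \<in> carrier P. \<zero>\<^bsub>K\<^esub>) (?I, \<epsilon> n)"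
      unfolding CompJ using q(2) mod_hom_closed[OF \<epsilon>] by (auto simp: compose_def)
  qed (use J right small zero \<pi> \<epsilon> q(1) in \<open>auto simp: HomJ\<close>)
  then show ?thesis by blast
qed

text \<open>
  Dually, the left \<open>R\<close>-modules embed covariantly by \<open>U \<mapsto> (U, 0, 0)\<close>, hence contravariantly into the
  opposite of the adjoint category.
\<close>

lemma op_cat_Adj_lossy_copower:
  fixes R :: "('r, 'p) ring_scheme" and S :: "('s, 'q) ring_scheme"
    and W :: "('r, 's, 'w, 'c) bimodule_scheme" and \<U> :: "'x set set"
  assumes R: "ring R" "\<one>\<^bsub>R\<^esub> \<noteq> \<zero>\<^bsub>R\<^esub>" and S: "ring S" and W: "is_bimodule R S W"
    and \<U>: "module_universe \<U>" "small_in (carrier R) \<U>"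
  shows "\<exists>A P K z i p f g. lossy_copower (op_cat (Adj \<U> R S W)) A P K z i p f g"
proof -
  obtain A P K :: "('r, 'x) module" and \<pi> \<epsilon> q where pwq: "power_with_quotient R A P K \<pi> \<epsilon> q"
    and small: "carrier A \<in> \<U>" "carrier P \<in> \<U>" "carrier K \<in> \<U>"
    using power_with_quotient_exists[OF R \<U>] by auto
  then have left: "left_module R A" "left_module R P" "left_module R K"
    and \<pi>: "\<And>n. \<pi> n \<in> mod_hom R P A" and \<epsilon>: "\<And>n. \<epsilon> n \<in> mod_hom R A P"
    and \<pi>\<epsilon>: "\<And>m n a. a \<in> carrier A \<Longrightarrow> \<pi> m (\<epsilon> n a) = (if m = n then a else \<zero>\<^bsub>A\<^esub>)"
    and sep: "\<And>x y. \<lbrakk>x \<in> carrier P; y \<in> carrier P; \<And>n. \<pi> n x = \<pi> n y\<rbrakk> \<Longrightarrow> x = y"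
    and q: "q \<in> mod_hom R P K" "\<And>n a. a \<in> carrier A \<Longrightarrow> q (\<epsilon> n a) = \<zero>\<^bsub>K\<^esub>"
      "\<exists>x \<in> carrier P. q x \<noteq> \<zero>\<^bsub>K\<^esub>"
    unfolding power_with_quotient_def by simp_all
  let ?Z = "zero_module :: ('s, 'x) module" and ?C = "op_cat (Adj \<U> R S W)"
  have Z: "right_module S ?Z" "carrier ?Z \<in> \<U>"
    using left_module_zero_module[OF ring_op_ring[OF S]] right_module_iff_left_module_op_ring[OF S]
      carrier_zero_module_in_universe[OF \<U>] ring.ring_simprules(6)[OF R(1)] by auto
  define J :: "('r, 'x) module \<Rightarrow> ('r, 'x) module \<times> ('s, 'x) module \<times> ('x \<Rightarrow> 'x \<Rightarrow> 'w)"
    where "J U = (U, zero_module, \<lambda>u v. \<zero>\<^bsub>W\<^esub>)" for U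
  let ?I = "\<lambda>x \<in> carrier ?Z. x"
  note op_simps = op_cat_simps Adj_simps
  have idZ: "?I \<in> mod_hom S ?Z ?Z" by (rule mod_hom_Id[OF right_module_basics[OF Z(1)]])
  have J: "J U \<in> Obj ?C" if "left_module R U" "carrier U \<in> \<U>" for U
    using that Z bimap_zero[OF W] by (simp add: J_def op_simps)
  have HomJ: "(\<mu>, \<nu>) \<in> Hom ?C (J U) (J U') \<longleftrightarrow> \<mu> \<in> mod_hom R U' U \<and> \<nu> = ?I" for \<mu> \<nu> U U'
    unfolding J_def op_simps using idZ mod_hom_to_zero_module_unique[OF _ idZ] by blast
  have CompJ: "Comp ?C (J U) (J U') (J U'') (\<mu>, ?I) (\<mu>', ?I) = (compose (carrier U'') \<mu> \<mu>', ?I)"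
    for \<mu> \<mu>' U U' U'' by (simp add: J_def op_simps compose_def cong: restrict_cong)
  have zero: "(\<lambda>a \<in> carrier A. \<zero>\<^bsub>A\<^esub>) \<in> mod_hom R A A" "(\<lambda>x \<in> carrier P. \<zero>\<^bsub>K\<^esub>) \<in> mod_hom R P K"
    using zero_mod_hom[OF left(1,1)] zero_mod_hom[OF left(2,3)] by simp_all
  have "lossy_copower ?C (J A) (J P) (J K) (\<lambda>a \<in> carrier A. \<zero>\<^bsub>A\<^esub>, ?I) (\<lambda>n. (\<pi> n, ?I))
    (\<lambda>n. (\<epsilon> n, ?I)) (q, ?I) (\<lambda>x \<in> carrier P. \<zero>\<^bsub>K\<^esub>, ?I)"
    unfolding lossy_copower_def
  proof (intro conjI allI ballI impI)
    fix e assume "e \<in> Hom ?C (J A) (J A)"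
    then obtain \<mu> where e: "e = (\<mu>, ?I)" "\<mu> \<in> mod_hom R A A" using HomJ by (metis surj_pair)
    have "\<mu> \<zero>\<^bsub>A\<^esub> = \<zero>\<^bsub>A\<^esub>"
      using e(2) mod_hom_zero left_module_basics(1)[OF left(1)] by blast
    then show "Comp ?C (J A) (J A) (J A) e (\<lambda>a \<in> carrier A. \<zero>\<^bsub>A\<^esub>, ?I) = (\<lambda>a \<in> carrier A. \<zero>\<^bsub>A\<^esub>, ?I)"
      unfolding e CompJ by (auto simp: compose_def)
  next
    fix m n
    show "Comp ?C (J A) (J P) (J A) (\<pi> m, ?I) (\<epsilon> n, ?I) =
        (if m = n then Id ?C (J A) else (\<lambda>a \<in> carrier A. \<zero>\<^bsub>A\<^esub>, ?I))"
      unfolding CompJ by (auto simp: J_def op_simps compose_def \<pi>\<epsilon>)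
  next
    fix X h h' assume X: "X \<in> Obj ?C" and h: "h \<in> Hom ?C (J P) X" "h' \<in> Hom ?C (J P) X"
      and eq: "\<forall>n. Comp ?C (J A) (J P) X (\<pi> n, ?I) h = Comp ?C (J A) (J P) X (\<pi> n, ?I) h'"
    obtain U V B \<mu> \<nu> \<mu>' \<nu>' where [simp]: "X = (U, V, B)" "h = (\<mu>, \<nu>)" "h' = (\<mu>', \<nu>')"
      by (metis surj_pair)
    have V: "right_module S V" and \<nu>: "\<nu> \<in> mod_hom S ?Z V" "\<nu>' \<in> mod_hom S ?Z V"
      and \<mu>: "\<mu> \<in> mod_hom R U P" "\<mu>' \<in> mod_hom R U P"
      using X h by (auto simp: J_def op_simps)
    have "\<nu> = \<nu>'" by (rule mod_hom_from_zero_module_unique[OF right_module_basics(1)[OF V] \<nu>])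
    moreover have "\<mu> = \<mu>'"
    proof (rule mod_hom_eqI[OF \<mu>])
      fix u assume u: "u \<in> carrier U"
      have "compose (carrier U) (\<pi> n) \<mu> = compose (carrier U) (\<pi> n) \<mu>'" for n
        using eq by (simp add: J_def op_simps)
      then have "\<pi> n (\<mu> u) = \<pi> n (\<mu>' u)" for n using u by (metis compose_eq)
      then show "\<mu> u = \<mu>' u" using sep mod_hom_closed[OF \<mu>(1) u] mod_hom_closed[OF \<mu>(2) u] by blast
    qed
    ultimately show "h = h'" by simp
  next
    show "(q, ?I) \<noteq> (\<lambda>x \<in> carrier P. \<zero>\<^bsub>K\<^esub>, ?I)" using q(3) by auto
  next
    fix n
    show "Comp ?C (J K) (J P) (J A) (q, ?I) (\<epsilon> n, ?I) =
        Comp ?C (J K) (J P) (J A) (\<lambda>x \<in> carrier P. \<zero>\<^bsub>K\<^esub>, ?I) (\<epsilon> n, ?I)"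
      unfolding CompJ using q(2) mod_hom_closed[OF \<epsilon>] by (auto simp: compose_def)
  qed (use J left small zero \<pi> \<epsilon> q(1) in \<open>auto simp: HomJ\<close>)
  then show ?thesis by blast
qed

section \<open>Adjoint categories are not module categories\<close>

theorem theorem2p10:
  fixes R :: "('r, 'p) ring_scheme"
    and S :: "('s, 'q) ring_scheme"
    and W :: "('r, 's, 'w, 'c) bimodule_scheme"
    and \<U> :: "'x set set"
  assumes "ring R" and "\<one>\<^bsub>R\<^esub> \<noteq> \<zero>\<^bsub>R\<^esub>"
    and "ring S" and "\<one>\<^bsub>S\<^esub> \<noteq> \<zero>\<^bsub>S\<^esub>"
    and "is_bimodule R S W"
    and "module_universe \<U>" and "small_in (carrier R) \<U>" and "small_in (carrier S) \<U>"
  shows "\<forall>T :: 't ring. ring T \<longrightarrow>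
      \<not> equivalent_categories (Adj \<U> R S W) (LMod \<U> T) \<and>
      \<not> equivalent_categories (Adj \<U> R S W) (RMod \<U> T) \<and>
      \<not> equivalent_categories (Adj \<U> R S W) (op_cat (LMod \<U> T)) \<and>
      \<not> equivalent_categories (Adj \<U> R S W) (op_cat (RMod \<U> T))"
proof -
  have left: "\<not> equivalent_categories (Adj \<U> R S W) (LMod \<U> T)" for T :: "('t, 'e) ring_scheme"
  proof
    assume "equivalent_categories (Adj \<U> R S W) (LMod \<U> T)"
    from equivalent_categories_weak_equivalence[OF category_Adj category_LMod this]
    obtain F\<^sub>o F\<^sub>m where F: "weak_equivalence (Adj \<U> R S W) (LMod \<U> T) F\<^sub>o F\<^sub>m"
      by (elim exE)
    from Adj_lossy_copower[OF assms(1,3-6,8)]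
    obtain A P K z i p f g where lossy: "lossy_copower (Adj \<U> R S W) A P K z i p f g"
      by (elim exE)
    show False
      by (rule notE[OF LMod_not_lossy_copower[OF assms(6)]
            lossy_copower_weak_equivalence[OF category_Adj category_LMod F lossy]])
  qed
  have op: "\<not> equivalent_categories (Adj \<U> R S W) (op_cat (LMod \<U> T))"
    for T :: "('t, 'e) ring_scheme"
  proof
    assume "equivalent_categories (Adj \<U> R S W) (op_cat (LMod \<U> T))"
    from equivalent_categories_weak_equivalence[OF category_Adj category_op_cat[OF category_LMod] this]
    obtain F\<^sub>o F\<^sub>m where "weak_equivalence (Adj \<U> R S W) (op_cat (LMod \<U> T)) F\<^sub>o F\<^sub>m"
      by (elim exE)
    from weak_equivalence_op_cat[OF this]
    have F: "weak_equivalence (op_cat (Adj \<U> R S W)) (LMod \<U> T) F\<^sub>o (\<lambda>a b. F\<^sub>m b a)"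
      by (simp only: op_cat_op_cat)
    from op_cat_Adj_lossy_copower[OF assms(1-3,5-7)]
    obtain A P K z i p f g where lossy: "lossy_copower (op_cat (Adj \<U> R S W)) A P K z i p f g"
      by (elim exE)
    show False
      by (rule notE[OF LMod_not_lossy_copower[OF assms(6)]
            lossy_copower_weak_equivalence[OF category_op_cat[OF category_Adj] category_LMod F lossy]])
  qed
  show ?thesis
  proof (intro allI impI conjI)
    fix T :: "'t ring" assume "ring T"
    then have T: "RMod \<U> T = LMod \<U> (op_ring T)" by (rule RMod_eq_LMod_op_ring)
    show "\<not> equivalent_categories (Adj \<U> R S W) (LMod \<U> T)" by (rule left)
    show "\<not> equivalent_categories (Adj \<U> R S W) (RMod \<U> T)" unfolding T by (rule left)
    show "\<not> equivalent_categories (Adj \<U> R S W) (op_cat (LMod \<U> T))" by (rule op)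
    show "\<not> equivalent_categories (Adj \<U> R S W) (op_cat (RMod \<U> T))" unfolding T by (rule op)
  qed
qed

end
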